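(* (i) There is a relation $R_1(X,\alpha)$ which is computed by some uniform polynomial size family of comparator oracle circuits, but which cannot be computed by any $\mathsf{NC}(\alpha)$ circuit family (uniform or not), even when the oracle $\alpha$ is restricted to be strictly 1-Lipschitz. (ii) There is a relation $R_2(X,\alpha)$ which is computed by some uniform $\mathsf{NC}^3(\alpha)$ circuit family, but which cannot be computed by any polynomial size family of comparator oracle circuits (uniform or not), even when the oracle $\alpha$ is restricted to be strictly 1-Lipschitz.
   Context: Oracles are length-preserving functions $\alpha:\{0,1\}^*\to\{0,1\}^*$; $\alpha_n$ denotes the restriction to $\{0,1\}^n$. A length-preserving (partial) function $\alpha$ is 1-Lipschitz if whenever $|X|=|X'|$ and $X,X'$ have Hamming distance $1$, $\alpha(X),\alpha(X')$ have Hamming distance at most $1$; it is strictly 1-Lipschitz if in that case $\alpha(X),\alpha(X')$ have Hamming distance exactly $1$. A comparator oracle circuit is an annotated comparator circuit (wires whose inputs are annotated by input bits, negated input bits or constants, a distinguished output wire, and a sequence of gates) whose gates may be comparator gates (mapping values $(p,q)$ on two wires to $(p\wedge q,p\vee q)$), negation gates on a single wire, and $\alpha_n$ oracle gates, where $n=|X|$; an oracle gate takes $n$ distinct wires as its inputs at some level and places its $n$ outputs on $n$ distinct wires. A relation $R(X,\alpha)$ is computed by a family of such circuits if for every $X$ and every (allowed) oracle $\alpha$ the circuit for length $|X|$ outputs $R(X,\alpha)$. $\mathsf{NC}^k(\alpha)$ is the class of relations computed by families of polynomial size Boolean circuits of depth $O(\log^k n)$ with fan-in-two $\wedge,\vee$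 gates, $\neg$ gates, and $\alpha_n$ oracle gates, in which oracle gates are nested at most $O(\log^{k-1}n)$ deep (the nesting depth of an oracle gate is the maximum number of oracle gates, including itself, on any path from a circuit input to it); $\mathsf{NC}(\alpha)=\bigcup_k\mathsf{NC}^k(\alpha)$. *)

theory Defs
  imports Complex_Main "HOL-Library.Landau_Symbols"
begin

section \<open>Oracles\<close>

type_synonym oracle_fun = "bool list \<Rightarrow> bool list"

definition length_preserving :: "oracle_fun \<Rightarrow> bool" where
  "length_preserving \<alpha> \<longleftrightarrow> (\<forall>X. length (\<alpha> X) = length X)"

text \<open>Only used for lists of equal length.\<close>

definition hamming :: "bool list \<Rightarrow> bool list \<Rightarrow> nat" where
  "hamming X Y = card {i. i < length X \<and> X ! i \<noteq> Y ! i}"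

definition strictly_1_Lipschitz :: "oracle_fun \<Rightarrow> bool" where
  "strictly_1_Lipschitz \<alpha> \<longleftrightarrow>
     (\<forall>X X'. length X = length X' \<and> hamming X X' = 1 \<longrightarrow> hamming (\<alpha> X) (\<alpha> X') = 1)"

definition Oracles :: "oracle_fun set" where
  "Oracles = {\<alpha>. length_preserving \<alpha>}"

definition Strict_Lipschitz_Oracles :: "oracle_fun set" where
  "Strict_Lipschitz_Oracles = {\<alpha>. length_preserving \<alpha> \<and> strictly_1_Lipschitz \<alpha>}"

text \<open>
  A relation \<open>R(X, \<alpha>)\<close>. In the circuit models below, a circuit for inputs of
  length \<open>n\<close> consults \<open>\<alpha>\<close> on strings of length \<open>n\<close> only.
\<close>

type_synonym relation = "bool list \<Rightarrow> oracle_fun \<Rightarrow> bool"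


section \<open>Uniformity\<close>

text \<open>
  Uniform means \<open>AC\<^sup>0\<close>-uniform. A relation on numbers presented in unary is in
  (uniform) \<open>AC\<^sup>0\<close> iff it is definable by a first-order formula over \<open>+\<close>, \<open>\<times>\<close>, \<open><\<close> and
  \<open>BIT\<close> in which every quantifier is bounded by a term in the other variables, that is,
  by a polynomial. A circuit family is uniform if the relation that describes its
  \<open>n\<close>-th circuit gate by gate, with \<open>n\<close> as an additional argument, is of this kind.
  This implies logspace and polynomial time uniformity.
\<close>

datatype tm = Var nat | Num nat | Plus tm tm | Times tm tm

datatype fm = Eq tm tm | Less tm tm | Bit tm tm | Neg fm | Conj fm fm | ExLess nat tm fm

primrec tm_val :: "(nat \<Rightarrow> nat) \<Rightarrow> tm \<Rightarrow> nat" where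
  "tm_val e (Var x) = e x"
| "tm_val e (Num c) = c"
| "tm_val e (Plus s t) = tm_val e s + tm_val e t"
| "tm_val e (Times s t) = tm_val e s * tm_val e t"

primrec sat :: "(nat \<Rightarrow> nat) \<Rightarrow> fm \<Rightarrow> bool" where
  "sat e (Eq s t) \<longleftrightarrow> tm_val e s = tm_val e t"
| "sat e (Less s t) \<longleftrightarrow> tm_val e s < tm_val e t"
| "sat e (Bit s t) \<longleftrightarrow> bit (tm_val e s) (tm_val e t)"
| "sat e (Neg f) \<longleftrightarrow> \<not> sat e f"
| "sat e (Conj f g) \<longleftrightarrow> sat e f \<and> sat e g"
| "sat e (ExLess x t f) \<longleftrightarrow> (\<exists>v < tm_val e t. sat (e(x := v)) f)"

text \<open>\<open>k\<close>-ary relations, given as predicates on lists of length \<open>k\<close>.\<close>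

definition AC0_relation :: "nat \<Rightarrow> (nat list \<Rightarrow> bool) \<Rightarrow> bool" where
  "AC0_relation k P \<longleftrightarrow>
     (\<exists>f. \<forall>xs. length xs = k \<longrightarrow> P xs = sat (\<lambda>i. if i < k then xs ! i else 0) f)"

text \<open>\<open>D n\<close> is the description, a set of \<open>k\<close>-tuples, of the \<open>n\<close>-th circuit.\<close>

definition AC0_uniform :: "nat \<Rightarrow> (nat \<Rightarrow> nat list set) \<Rightarrow> bool" where
  "AC0_uniform k D \<longleftrightarrow> AC0_relation (Suc k) (\<lambda>xs. tl xs \<in> D (hd xs))"


section \<open>Comparator circuits with oracles\<close>

datatype annotation = AConst bool | APos nat | ANeg nat

text \<open>
  \<open>Comparator i j\<close> puts the conjunction on wire \<open>i\<close> and the disjunction on wire \<open>j\<close>.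
  \<open>COracle is os\<close> reads its inputs from the wires \<open>is\<close> and places its outputs on the
  wires \<open>os\<close> (in this order).
\<close>

datatype cgate = Comparator nat nat | CNot nat | COracle "nat list" "nat list"

record ccircuit =
  annotations :: "annotation list"
  cgates :: "cgate list"
  cout :: nat

abbreviation wires :: "ccircuit \<Rightarrow> nat" where
  "wires C \<equiv> length (annotations C)"

fun wf_annotation :: "nat \<Rightarrow> annotation \<Rightarrow> bool" where
  "wf_annotation n (AConst b) \<longleftrightarrow> True"
| "wf_annotation n (APos i) \<longleftrightarrow> i < n"
| "wf_annotation n (ANeg i) \<longleftrightarrow> i < n"

text \<open>The first argument is the input length, the second one the number of wires.\<close>

fun wf_cgate :: "nat \<Rightarrow> nat \<Rightarrow> cgate \<Rightarrow> bool" where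
  "wf_cgate n m (Comparator i j) \<longleftrightarrow> i < m \<and> j < m \<and> i \<noteq> j"
| "wf_cgate n m (CNot i) \<longleftrightarrow> i < m"
| "wf_cgate n m (COracle is os) \<longleftrightarrow>
     length is = n \<and> distinct is \<and> set is \<subseteq> {..<m} \<and>
     length os = n \<and> distinct os \<and> set os \<subseteq> {..<m}"

definition wf_ccircuit :: "nat \<Rightarrow> ccircuit \<Rightarrow> bool" where
  "wf_ccircuit n C \<longleftrightarrow>
     (\<forall>a \<in> set (annotations C). wf_annotation n a) \<and>
     (\<forall>g \<in> set (cgates C). wf_cgate n (wires C) g) \<and>
     cout C < wires C"

fun annotation_val :: "bool list \<Rightarrow> annotation \<Rightarrow> bool" where
  "annotation_val X (AConst b) = b"
| "annotation_val X (APos i) = X ! i"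
| "annotation_val X (ANeg i) = (\<not> X ! i)"

definition place :: "nat list \<Rightarrow> bool list \<Rightarrow> bool list \<Rightarrow> bool list" where
  "place ws bs v = fold (\<lambda>(w, b) v. v[w := b]) (zip ws bs) v"

text \<open>
  Gates for \<open>\<alpha>\<^sub>n\<close> consume their inputs: an input wire that is not also an output wire
  carries the constant 0 afterwards. If it kept its value, applying the gate repeatedly to
  the same inputs would copy \<open>\<alpha>\<^sub>n(Y)\<close> any number of times, which defeats the restricted
  fan-out of comparator circuits. This way, for a 1-Lipschitz \<open>\<alpha>\<close>, flipping one wire
  before any gate flips at most one wire after it.
\<close>

fun cgate_step :: "oracle_fun \<Rightarrow> cgate \<Rightarrow> bool list \<Rightarrow> bool list" where
  "cgate_step \<alpha> (Comparator i j) v = v[i := v ! i \<and> v ! j, j := v ! i \<or> v ! j]"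
| "cgate_step \<alpha> (CNot i) v = v[i := \<not> v ! i]"
| "cgate_step \<alpha> (COracle is os) v =
     place os (\<alpha> (map ((!) v) is)) (place is (replicate (length is) False) v)"

definition ceval :: "oracle_fun \<Rightarrow> bool list \<Rightarrow> ccircuit \<Rightarrow> bool" where
  "ceval \<alpha> X C =
     fold (cgate_step \<alpha>) (cgates C) (map (annotation_val X) (annotations C)) ! cout C"

definition csize :: "ccircuit \<Rightarrow> nat" where
  "csize C = wires C + length (cgates C)"

fun annotation_code :: "annotation \<Rightarrow> nat list" where
  "annotation_code (AConst b) = [0, of_bool b]"
| "annotation_code (APos i) = [1, i]"
| "annotation_code (ANeg i) = [2, i]"

fun cgate_desc :: "cgate \<Rightarrow> nat list set" where
  "cgate_desc (Comparator i j) = {[0, i, j]}"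
| "cgate_desc (CNot i) = {[1, i, 0]}"
| "cgate_desc (COracle is os) =
     {[2, 0, 0]} \<union> {[3, p, is ! p] | p. p < length is} \<union> {[4, p, os ! p] | p. p < length os}"

definition ccircuit_desc :: "ccircuit \<Rightarrow> nat list set" where
  "ccircuit_desc C =
     {[0, 0, 0, 0, cout C]} \<union>
     {[1, i, 0] @ annotation_code (annotations C ! i) | i. i < wires C} \<union>
     {[2, k] @ d | k d. k < length (cgates C) \<and> d \<in> cgate_desc (cgates C ! k)}"

definition comparator_family :: "(nat \<Rightarrow> ccircuit) \<Rightarrow> bool" where
  "comparator_family C \<longleftrightarrow>
     (\<forall>n. wf_ccircuit n (C n)) \<and> (\<exists>c. (\<lambda>n. real (csize (C n))) \<in> O(\<lambda>n. real n ^ c))"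

definition uniform_comparator_family :: "(nat \<Rightarrow> ccircuit) \<Rightarrow> bool" where
  "uniform_comparator_family C \<longleftrightarrow>
     comparator_family C \<and> AC0_uniform 5 (\<lambda>n. ccircuit_desc (C n))"

text \<open>The circuits have to be correct for all oracles in \<open>A\<close>.\<close>

definition ccomputes :: "oracle_fun set \<Rightarrow> (nat \<Rightarrow> ccircuit) \<Rightarrow> relation \<Rightarrow> bool" where
  "ccomputes A C R \<longleftrightarrow> (\<forall>X. \<forall>\<alpha> \<in> A. ceval \<alpha> X (C (length X)) = R X \<alpha>)"


section \<open>Boolean circuits with oracles\<close>

text \<open>\<open>SGate k p\<close> is the output number \<open>p\<close> of the gate number \<open>k\<close>.\<close>

datatype source = SConst bool | SInput nat | SGate nat nat

datatype bgate = BNot source | BAnd source source | BOr source source | BOracle "source list"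

text \<open>The gates are listed in topological order.\<close>

record bcircuit =
  bgates :: "bgate list"
  bout :: source

fun sources :: "bgate \<Rightarrow> source list" where
  "sources (BNot s) = [s]"
| "sources (BAnd s t) = [s, t]"
| "sources (BOr s t) = [s, t]"
| "sources (BOracle ss) = ss"

fun is_oracle :: "bgate \<Rightarrow> bool" where
  "is_oracle (BOracle ss) = True"
| "is_oracle _ = False"

definition outputs :: "nat \<Rightarrow> bgate \<Rightarrow> nat" where
  "outputs n g = (if is_oracle g then n else 1)"

text \<open>\<open>gs\<close> is the list of gates that may be referred to.\<close>

fun wf_source :: "nat \<Rightarrow> bgate list \<Rightarrow> source \<Rightarrow> bool" where
  "wf_source n gs (SConst b) \<longleftrightarrow> True"
| "wf_source n gs (SInput i) \<longleftrightarrow> i < n"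
| "wf_source n gs (SGate k p) \<longleftrightarrow> k < length gs \<and> p < outputs n (gs ! k)"

definition wf_bcircuit :: "nat \<Rightarrow> bcircuit \<Rightarrow> bool" where
  "wf_bcircuit n C \<longleftrightarrow>
     (\<forall>k < length (bgates C).
        (\<forall>s \<in> set (sources (bgates C ! k)). wf_source n (take k (bgates C)) s) \<and>
        (is_oracle (bgates C ! k) \<longrightarrow> length (sources (bgates C ! k)) = n)) \<and>
     wf_source n (bgates C) (bout C)"

text \<open>\<open>vs\<close> lists, for each gate evaluated so far, the values of its outputs.\<close>

fun source_val :: "bool list \<Rightarrow> bool list list \<Rightarrow> source \<Rightarrow> bool" where
  "source_val X vs (SConst b) = b"
| "source_val X vs (SInput i) = X ! i"
| "source_val X vs (SGate k p) = vs ! k ! p"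

fun bgate_val :: "oracle_fun \<Rightarrow> bool list \<Rightarrow> bool list list \<Rightarrow> bgate \<Rightarrow> bool list" where
  "bgate_val \<alpha> X vs (BNot s) = [\<not> source_val X vs s]"
| "bgate_val \<alpha> X vs (BAnd s t) = [source_val X vs s \<and> source_val X vs t]"
| "bgate_val \<alpha> X vs (BOr s t) = [source_val X vs s \<or> source_val X vs t]"
| "bgate_val \<alpha> X vs (BOracle ss) = \<alpha> (map (source_val X vs) ss)"

definition beval :: "oracle_fun \<Rightarrow> bool list \<Rightarrow> bcircuit \<Rightarrow> bool" where
  "beval \<alpha> X C =
     source_val X (foldl (\<lambda>vs g. vs @ [bgate_val \<alpha> X vs g]) [] (bgates C)) (bout C)"

definition bsize :: "bcircuit \<Rightarrow> nat" where
  "bsize C = length (bgates C)"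

text \<open>
  \<open>max_path w gs\<close> is the maximal number of gates satisfying \<open>w\<close> on a path through the
  circuit. The lists built up contain the maximum for the paths ending at each gate.
\<close>

fun source_depth :: "nat list \<Rightarrow> source \<Rightarrow> nat" where
  "source_depth ds (SConst b) = 0"
| "source_depth ds (SInput i) = 0"
| "source_depth ds (SGate k p) = ds ! k"

definition gate_depths :: "(bgate \<Rightarrow> bool) \<Rightarrow> bgate list \<Rightarrow> nat list" where
  "gate_depths w gs =
     foldl (\<lambda>ds g. ds @ [of_bool (w g) + Max (insert 0 (source_depth ds ` set (sources g)))])
       [] gs"

definition max_path :: "(bgate \<Rightarrow> bool) \<Rightarrow> bgate list \<Rightarrow> nat" where
  "max_path w gs = Max (insert 0 (set (gate_depths w gs)))"

definition bdepth :: "bcircuit \<Rightarrow> nat" where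
  "bdepth C = max_path (\<lambda>g. True) (bgates C)"

definition oracle_depth :: "bcircuit \<Rightarrow> nat" where
  "oracle_depth C = max_path is_oracle (bgates C)"

fun source_code :: "source \<Rightarrow> nat list" where
  "source_code (SConst b) = [0, of_bool b, 0]"
| "source_code (SInput i) = [1, i, 0]"
| "source_code (SGate k p) = [2, k, p]"

fun bgate_kind :: "bgate \<Rightarrow> nat" where
  "bgate_kind (BNot s) = 0"
| "bgate_kind (BAnd s t) = 1"
| "bgate_kind (BOr s t) = 2"
| "bgate_kind (BOracle ss) = 3"

definition bcircuit_desc :: "bcircuit \<Rightarrow> nat list set" where
  "bcircuit_desc C =
     {[0, 0, 0] @ source_code (bout C)} \<union>
     {[1, k, bgate_kind (bgates C ! k), 0, 0, 0] | k. k < length (bgates C)} \<union>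
     {[2, k, p] @ source_code (sources (bgates C ! k) ! p) | k p.
        k < length (bgates C) \<and> p < length (sources (bgates C ! k))}"

definition NC_family :: "nat \<Rightarrow> (nat \<Rightarrow> bcircuit) \<Rightarrow> bool" where
  "NC_family k C \<longleftrightarrow>
     (\<forall>n. wf_bcircuit n (C n)) \<and>
     (\<exists>c. (\<lambda>n. real (bsize (C n))) \<in> O(\<lambda>n. real n ^ c)) \<and>
     (\<lambda>n. real (bdepth (C n))) \<in> O(\<lambda>n. log 2 (real n) ^ k) \<and>
     (\<lambda>n. real (oracle_depth (C n))) \<in> O(\<lambda>n. log 2 (real n) ^ (k - 1))"

definition uniform_NC_family :: "nat \<Rightarrow> (nat \<Rightarrow> bcircuit) \<Rightarrow> bool" where
  "uniform_NC_family k C \<longleftrightarrow> NC_family k C \<and> AC0_uniform 6 (\<lambda>n. bcircuit_desc (C n))"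

definition bcomputes :: "oracle_fun set \<Rightarrow> (nat \<Rightarrow> bcircuit) \<Rightarrow> relation \<Rightarrow> bool" where
  "bcomputes A C R \<longleftrightarrow> (\<forall>X. \<forall>\<alpha> \<in> A. beval \<alpha> X (C (length X)) = R X \<alpha>)"

end

theory Submission
  imports Defs "HOL-Library.FuncSet" "HOL-Library.Discrete_Functions"
begin

text \<open>
  Both relations ask for a bit of an iterate. \<open>R\<^sub>1\<close> iterates \<open>\<alpha>\<close> itself about \<open>n\<^bsup>1/8\<^esup>\<close> times.
  \<open>R\<^sub>2\<close> iterates \<open>\<alpha>\<close> about \<open>log\<^sup>2 n\<close> times, where each output bit that is kept is
  copied to five positions of the next query.

  The hard functions \<open>\<alpha>\<close> map every string to \<open>0\<dots>0\<close> or \<open>10\<dots>0\<close>, according to its parity,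
  except on disjoint balls about the points \<open>P\<^sub>0, P\<^sub>1, \<dots>\<close> of the iteration. In the ball about
  \<open>P\<^sub>i\<close>, the value moves on a geodesic from \<open>0\<dots>0\<close> to its target \<open>Q\<^sub>i\<close> as the argument
  approaches \<open>P\<^sub>i\<close>; the radius of the ball is the weight of \<open>Q\<^sub>i\<close>. The points are built from
  words of a code of superpolynomial size with small pairwise intersections. Hence a query is
  close to at most one codeword, and codewords that are not hit can be chosen greedily. The ball
  about \<open>P\<^sub>i\<^sub>+\<^sub>1\<close> can then only be reached by way of a query in the ball about \<open>P\<^sub>i\<close>.

  For \<open>R\<^sub>1\<close>, a query at nesting depth \<open>i\<close> does not reach the ball about \<open>P\<^sub>i\<close>. For \<open>R\<^sub>2\<close>,
  compare the runs of a comparator circuit with and without the ball about \<open>P\<^sub>i\<close>. The wires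
  on which they differ are tokens: no gate creates any by itself, a query in the ball about
  \<open>P\<^sub>i\<close> creates at most \<open>w = |Q\<^sub>i|\<close> of them, and one in the ball about \<open>P\<^sub>i\<^sub>+\<^sub>1\<close> destroys at
  least \<open>2w\<close>, since \<open>P\<^sub>i\<^sub>+\<^sub>1\<close> has weight \<open>5w\<close>. So there are at least twice as many queries in the
  ball about \<open>P\<^sub>i\<close> as in the next one.
\<close>

section \<open>Sets of positions as points of the cube\<close>

definition sdist :: "nat set \<Rightarrow> nat set \<Rightarrow> nat" where
  "sdist A B = card ((A - B) \<union> (B - A))"

lemma sdist_self [simp]: "sdist A A = 0"
  by (simp add: sdist_def)

lemma sdist_commute: "sdist A B = sdist B A"
  by (simp add: sdist_def Un_commute)

lemma sdist_triangle:
  assumes "finite A" "finite B" "finite C"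
  shows "sdist A C \<le> sdist A B + sdist B C"
proof -
  have "sdist A C \<le> card (((A - B) \<union> (B - A)) \<union> ((B - C) \<union> (C - B)))"
    unfolding sdist_def using assms by (intro card_mono) auto
  also have "\<dots> \<le> sdist A B + sdist B C"
    unfolding sdist_def by (rule card_Un_le)
  finally show ?thesis .
qed

lemma sdist_add_card_Int:
  assumes "finite A" "finite B"
  shows "sdist A B + 2 * card (A \<inter> B) = card A + card B"
proof -
  have "sdist A B = card (A - B) + card (B - A)"
    unfolding sdist_def using assms by (intro card_Un_disjoint) auto
  moreover have "card A = card (A - B) + card (A \<inter> B)"
    using assms by (subst card_Un_disjoint [symmetric]) (auto intro: arg_cong [of _ _ card])
  moreover have "card B = card (B - A) + card (A \<inter> B)"
    using assms by (subst card_Un_disjoint [symmetric]) (auto intro: arg_cong [of _ _ card])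
  ultimately show ?thesis by simp
qed

lemma sdist_le_add:
  assumes "finite A" "finite B"
  shows "sdist A B \<le> card A + card B"
  using sdist_add_card_Int [OF assms] by simp

lemma even_sdist_iff:
  assumes "finite A" "finite B"
  shows "even (sdist A B) \<longleftrightarrow> even (card A + card B)"
  using sdist_add_card_Int [OF assms] by presburger

text \<open>The distance is a path metric: walking from \<open>A\<close> to \<open>B\<close> and
  correcting one element of the symmetric difference at a time stays inside \<open>{..<n}\<close>,
  and the triangle inequality adds up the edges.\<close>

lemma lipschitz_from_edges:
  assumes edge: "\<And>A B. A \<subseteq> {..<n} \<Longrightarrow> B \<subseteq> {..<n} \<Longrightarrow> sdist A B = 1 \<Longrightarrow> sdist (F A) (F B) = 1"
    and fin: "\<And>A. A \<subseteq> {..<n} \<Longrightarrow> finite (F A)"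
    and AB: "A \<subseteq> {..<n}" "B \<subseteq> {..<n}"
  shows "sdist (F A) (F B) \<le> sdist A B"
proof -
  have "sdist (F A) (F B) \<le> k" if "sdist A B = k" "A \<subseteq> {..<n}" "B \<subseteq> {..<n}" for k A
    using that
  proof (induction k arbitrary: A)
    case 0
    have "finite A" "finite B" using 0 by (auto intro: finite_subset)
    then have "A = B" using 0 unfolding sdist_def by auto
    then show ?case by simp
  next
    case (Suc k)
    have fAB: "finite A" "finite B" using Suc.prems by (auto intro: finite_subset)
    define D where "D = (A - B) \<union> (B - A)"
    have cD: "card D = Suc k" using Suc.prems by (simp add: D_def sdist_def)
    then obtain x where x: "x \<in> D" by fastforce
    define A' where "A' = (if x \<in> A then A - {x} else insert x A)"
    have sub: "A' \<subseteq> {..<n}" using Suc.prems x by (auto simp: A'_def D_def)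
    have "(A - A') \<union> (A' - A) = {x}" by (auto simp: A'_def)
    then have one: "sdist A A' = 1" by (simp add: sdist_def)
    have "(A' - B) \<union> (B - A') = D - {x}" using x by (auto simp: A'_def D_def)
    then have k: "sdist A' B = k" using cD x by (simp add: sdist_def)
    have "sdist (F A) (F B) \<le> sdist (F A) (F A') + sdist (F A') (F B)"
      using sub Suc.prems by (intro sdist_triangle fin) auto
    also have "\<dots> \<le> 1 + k"
      using edge [OF Suc.prems(2) sub one] Suc.IH [OF k sub Suc.prems(3)] by simp
    finally show ?case by simp
  qed
  then show ?thesis using AB by blast
qed

section \<open>Bit strings as subsets of \<open>{..<n}\<close>, and oracles given by set
  functions\<close>

definition ones :: "bool list \<Rightarrow> nat set" where
  "ones X = {i. i < length X \<and> X ! i}"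

definition bits :: "nat \<Rightarrow> nat set \<Rightarrow> bool list" where
  "bits n A = map (\<lambda>i. i \<in> A) [0..<n]"

lemma length_bits [simp]: "length (bits n A) = n"
  by (simp add: bits_def)

lemma nth_bits [simp]: "i < n \<Longrightarrow> bits n A ! i \<longleftrightarrow> i \<in> A"
  by (simp add: bits_def)

lemma ones_bits: "A \<subseteq> {..<n} \<Longrightarrow> ones (bits n A) = A"
  by (auto simp: ones_def)

lemma ones_subset: "ones X \<subseteq> {..<length X}"
  by (auto simp: ones_def)

lemma hamming_eq_sdist:
  assumes "length X = length Y"
  shows "hamming X Y = sdist (ones X) (ones Y)"
  unfolding hamming_def sdist_def ones_def using assms by (intro arg_cong [of _ _ card]) auto

text \<open>The identity at all other lengths is length-preserving and strictly 1-Lipschitz there,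
  so that only length \<open>n\<close> has to be designed.\<close>

definition set_oracle :: "nat \<Rightarrow> (nat set \<Rightarrow> nat set) \<Rightarrow> oracle_fun" where
  "set_oracle n F X = (if length X = n then bits n (F (ones X)) else X)"

lemma length_set_oracle [simp]: "length (set_oracle n F X) = length X"
  by (simp add: set_oracle_def)

lemma set_oracle_bits: "A \<subseteq> {..<n} \<Longrightarrow> set_oracle n F (bits n A) = bits n (F A)"
  by (simp add: set_oracle_def ones_bits)

lemma set_oracle_cong: "F (ones X) = G (ones X) \<Longrightarrow> set_oracle k F X = set_oracle k G X"
  by (simp add: set_oracle_def)

lemma set_oracle_strict:
  assumes edge: "\<And>A B. A \<subseteq> {..<n} \<Longrightarrow> B \<subseteq> {..<n} \<Longrightarrow> sdist A B = 1 \<Longrightarrow> sdist (F A) (F B) = 1"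
    and sub: "\<And>A. A \<subseteq> {..<n} \<Longrightarrow> F A \<subseteq> {..<n}"
  shows "set_oracle n F \<in> Strict_Lipschitz_Oracles"
proof -
  have "hamming (set_oracle n F X) (set_oracle n F Y) = 1"
    if l: "length X = length Y" and h: "hamming X Y = 1" for X Y
  proof (cases "length X = n")
    case True
    have sX: "ones X \<subseteq> {..<n}" and sY: "ones Y \<subseteq> {..<n}"
      using ones_subset [of X] ones_subset [of Y] True l by auto
    have "sdist (ones X) (ones Y) = 1"
      using h l by (simp add: hamming_eq_sdist)
    then have "sdist (F (ones X)) (F (ones Y)) = 1"
      using sX sY edge by blast
    then show ?thesis
      using True l sX sY sub by (simp add: set_oracle_def hamming_eq_sdist ones_bits)
  next
    case False
    then show ?thesis using that by (simp add: set_oracle_def)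
  qed
  then show ?thesis
    by (auto simp: Strict_Lipschitz_Oracles_def length_preserving_def strictly_1_Lipschitz_def)
qed

section \<open>Initial segments of a finite set: a geodesic from the empty set\<close>

definition least_elems :: "nat \<Rightarrow> nat set \<Rightarrow> nat set" where
  "least_elems h Q = set (take h (sorted_list_of_set Q))"

lemma least_elems_subset: "finite Q \<Longrightarrow> least_elems h Q \<subseteq> Q"
  unfolding least_elems_def using set_take_subset by fastforce

lemma finite_least_elems [simp]: "finite (least_elems h Q)"
  by (simp add: least_elems_def)

lemma least_elems_0 [simp]: "least_elems 0 Q = {}"
  by (simp add: least_elems_def)

lemma least_elems_card: "finite Q \<Longrightarrow> least_elems (card Q) Q = Q"
  by (simp add: least_elems_def)

lemma card_least_elems: "finite Q \<Longrightarrow> h \<le> card Q \<Longrightarrow> card (least_elems h Q) = h"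
  unfolding least_elems_def by (subst distinct_card) auto

text \<open>As \<open>0\<close> is the least natural number, every geodesic to a target containing
  \<open>0\<close> starts with the step from \<open>{}\<close> to \<open>{0}\<close>; so all its
  nonempty points absorb the parity term.\<close>

lemma least_elems_Suc_0:
  assumes "finite Q" "0 \<in> Q"
  shows "least_elems (Suc 0) Q = {0}"
proof -
  have "Q \<noteq> {}" using assms by auto
  have "sorted_list_of_set Q = Min Q # sorted_list_of_set (Q - {Min Q})"
    using assms \<open>Q \<noteq> {}\<close> by (intro sorted_list_of_set_nonempty)
  moreover have "Min Q = 0"
    using assms Min_le by fastforce
  ultimately show ?thesis by (simp add: least_elems_def)
qed

lemma least_elems_mono: "h \<le> k \<Longrightarrow> least_elems h Q \<subseteq> least_elems k Q"
  unfolding least_elems_def by (rule set_take_subset_set_take)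

lemma zero_in_least_elems:
  assumes "finite Q" "0 \<in> Q" "0 < h"
  shows "0 \<in> least_elems h Q"
  using least_elems_mono [of "Suc 0" h Q] least_elems_Suc_0 [of Q] assms by auto

lemma sdist_least_elems_Suc:
  assumes "finite Q" "Suc h \<le> card Q"
  shows "sdist (least_elems h Q) (least_elems (Suc h) Q) = 1"
proof -
  have s: "least_elems h Q \<subseteq> least_elems (Suc h) Q" by (rule least_elems_mono) simp
  then have "sdist (least_elems h Q) (least_elems (Suc h) Q)
    = card (least_elems (Suc h) Q - least_elems h Q)"
    unfolding sdist_def by (intro arg_cong [of _ _ card]) auto
  also have "\<dots> = card (least_elems (Suc h) Q) - card (least_elems h Q)"
    using s by (intro card_Diff_subset) auto
  finally show ?thesis using assms by (simp add: card_least_elems)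
qed

section \<open>Functions concentrated on balls\<close>

text \<open>A constant map would not be strictly 1-Lipschitz. Parity changes along every edge of the
  cube, so this map is, with values of weight at most one.\<close>

definition parity_set :: "nat set \<Rightarrow> nat set" where
  "parity_set A = (if odd (card A) then {0} else {})"

text \<open>
  The truncated subtraction empties the term for \<open>i\<close> outside the ball about \<open>P i\<close>. Inside it,
  the parity term is absorbed as \<open>0 \<in> Q i\<close>.
\<close>

definition bump :: "nat set \<Rightarrow> (nat \<Rightarrow> nat set) \<Rightarrow> (nat \<Rightarrow> nat set) \<Rightarrow> nat set \<Rightarrow> nat set" where
  "bump I P Q A = parity_set A \<union> (\<Union>i\<in>I. least_elems (card (Q i) - sdist A (P i)) (Q i))"

lemma bump_cong:
  assumes "\<And>i. i \<in> I \<Longrightarrow> P i = P' i" "\<And>i. i \<in> I \<Longrightarrow> Q i = Q' i"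
  shows "bump I P Q A = bump I P' Q' A"
  using assms by (simp add: bump_def)

text \<open>Balls that miss \<open>A\<close> contribute the empty set. This lets balls be added to
  or removed from an oracle without changing its answers to queries outside them.\<close>

lemma bump_eq_if_unhit:
  assumes "\<And>i. i \<in> I - J \<Longrightarrow> card (Q i) \<le> sdist A (P i)"
    and "\<And>i. i \<in> J - I \<Longrightarrow> card (Q i) \<le> sdist A (P i)"
  shows "bump I P Q A = bump J P Q A"
proof -
  have *: "least_elems (card (Q i) - sdist A (P i)) (Q i) = {}" if "i \<in> (I - J) \<union> (J - I)" for i
    using assms that by (metis UnE diff_is_0_eq least_elems_0)
  have "(\<Union>i\<in>I. least_elems (card (Q i) - sdist A (P i)) (Q i))
      = (\<Union>i\<in>J. least_elems (card (Q i) - sdist A (P i)) (Q i))"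
    using * by blast
  then show ?thesis by (simp add: bump_def)
qed

text \<open>\<open>far\<close> makes the balls disjoint. \<open>even_PQ\<close> glues a ball to its
  surroundings: on the sphere of radius \<open>card (Q i)\<close> about \<open>P i\<close> all
  points have even weight, so the parity term is empty just where the geodesic has shrunk to the
  empty set.\<close>

locale bumps =
  fixes n L :: nat and P Q :: "nat \<Rightarrow> nat set"
  assumes P_sub: "i < L \<Longrightarrow> P i \<subseteq> {..<n}"
    and Q_sub: "i < L \<Longrightarrow> Q i \<subseteq> {..<n}"
    and zero_Q: "i < L \<Longrightarrow> 0 \<in> Q i"
    and even_PQ: "i < L \<Longrightarrow> even (card (P i) + card (Q i))"
    and far: "i < L \<Longrightarrow> j < L \<Longrightarrow> i \<noteq> j \<Longrightarrow> card (Q i) + card (Q j) \<le> sdist (P i) (P j)"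
begin

abbreviation hit :: "nat \<Rightarrow> nat set \<Rightarrow> bool" where
  "hit i A \<equiv> sdist A (P i) < card (Q i)"

lemma finite_P: "i < L \<Longrightarrow> finite (P i)"
  using P_sub by (auto intro: finite_subset)

lemma finite_Q: "i < L \<Longrightarrow> finite (Q i)"
  using Q_sub by (auto intro: finite_subset)

lemma card_Q_pos: "i < L \<Longrightarrow> 0 < card (Q i)"
  using zero_Q finite_Q by (auto simp: card_gt_0_iff)

text \<open>For \<open>i\<close> the closed ball is allowed: a point on its boundary sphere lies in
  no other ball either, which \<open>bump_edge_hit\<close> uses when an edge leaves the
  ball.\<close>

lemma hit_unique:
  assumes "i < L" "j < L" "finite A" "sdist A (P i) \<le> card (Q i)" "hit j A"
  shows "i = j"
proof (rule ccontr)
  assume "i \<noteq> j"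
  then have "card (Q i) + card (Q j) \<le> sdist (P i) (P j)" using far assms by blast
  also have "\<dots> \<le> sdist (P i) A + sdist A (P j)"
    using assms finite_P by (intro sdist_triangle) auto
  finally show False using assms by (simp add: sdist_commute)
qed

lemma bump_hit:
  assumes "I \<subseteq> {..<L}" "i \<in> I" "finite A" "hit i A"
  shows "bump I P Q A = least_elems (card (Q i) - sdist A (P i)) (Q i)"
proof -
  have iL: "i < L" using assms by auto
  have "least_elems (card (Q j) - sdist A (P j)) (Q j) = {}" if "j \<in> I" "j \<noteq> i" for j
  proof -
    have "\<not> hit j A" using hit_unique [of j i A] that assms iL by fastforce
    then show ?thesis by simp
  qed
  then have "(\<Union>j\<in>I. least_elems (card (Q j) - sdist A (P j)) (Q j))
      = least_elems (card (Q i) - sdist A (P i)) (Q i)"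
    using assms(2) by blast
  moreover have "parity_set A \<subseteq> least_elems (card (Q i) - sdist A (P i)) (Q i)"
    using zero_in_least_elems [OF finite_Q zero_Q, OF iL iL] assms by (simp add: parity_set_def)
  ultimately show ?thesis by (auto simp: bump_def)
qed

lemma bump_unhit:
  assumes "\<And>i. i \<in> I \<Longrightarrow> \<not> hit i A"
  shows "bump I P Q A = parity_set A"
  using bump_eq_if_unhit [of I "{}" Q A P] assms by (force simp: bump_def)

lemma bump_center:
  assumes "I \<subseteq> {..<L}" "i \<in> I"
  shows "bump I P Q (P i) = Q i"
  using bump_hit [of I i "P i"] assms card_Q_pos finite_P least_elems_card finite_Q
  by (auto simp: subset_iff)

lemma finite_bump [simp]: "I \<subseteq> {..<L} \<Longrightarrow> finite (bump I P Q A)"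
  by (auto simp: bump_def parity_set_def finite_subset [of I])

lemma bump_sub:
  assumes "I \<subseteq> {..<L}" "0 < n"
  shows "bump I P Q A \<subseteq> {..<n}"
proof -
  have "least_elems h (Q i) \<subseteq> {..<n}" if "i \<in> I" for h i
    using least_elems_subset [OF finite_Q, of i h] Q_sub [of i] that assms by blast
  then show ?thesis
    unfolding bump_def parity_set_def using assms(2) by (auto split: if_splits)
qed

lemma card_bump_le:
  assumes "I \<subseteq> {..<L}" "finite A" "\<And>i. i < L \<Longrightarrow> card (Q i) \<le> w" "0 < w"
  shows "card (bump I P Q A) \<le> w"
proof (cases "\<exists>i\<in>I. hit i A")
  case True
  then obtain i where i: "i \<in> I" "hit i A" by blast
  then have "card (bump I P Q A) = card (Q i) - sdist A (P i)"
    using assms by (subst bump_hit [OF _ i(1)]) (auto intro!: card_least_elems finite_Q)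
  then show ?thesis using assms i by (metis diff_le_self lessThan_iff order_trans subsetD)
next
  case False
  then show ?thesis using assms(4) by (simp add: bump_unhit parity_set_def)
qed

text \<open>An edge leading away from the centre shortens the geodesic by one element. If it ends on
  the boundary sphere, then \<open>A\<close> has value \<open>{0}\<close>, no ball contributes at
  \<open>B\<close>, and \<open>B\<close> is even.\<close>

lemma bump_edge_hit:
  assumes I: "I \<subseteq> {..<L}" and A: "finite A" and B: "finite B" and one: "sdist A B = 1"
    and i: "i \<in> I" "hit i A" and le: "sdist A (P i) < sdist B (P i)"
  shows "sdist (bump I P Q A) (bump I P Q B) = 1"
proof -
  have iL: "i < L" using I i by auto
  define h where "h = card (Q i) - Suc (sdist A (P i))"
  have "sdist B (P i) \<le> sdist B A + sdist A (P i)"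
    using A B finite_P [OF iL] by (rule_tac sdist_triangle) auto
  then have dB: "sdist B (P i) = Suc (sdist A (P i))"
    using le one by (simp add: sdist_commute)
  have fA: "bump I P Q A = least_elems (Suc h) (Q i)"
    using bump_hit [OF I i(1) A i(2)] i(2) by (simp add: h_def Suc_diff_Suc)
  have fB: "bump I P Q B = least_elems h (Q i)"
  proof (cases "hit i B")
    case True
    then show ?thesis using bump_hit [OF I i(1) B True] dB by (simp add: h_def)
  next
    case False
    then have eq: "sdist B (P i) = card (Q i)" using dB i(2) by simp
    then have h: "h = 0" using dB by (simp add: h_def)
    have un: "\<not> hit j B" if "j \<in> I" for j
      using hit_unique [of i j B] iL I that B eq False by auto
    have "even (card B + card (P i))" if "odd (card B)"
      using even_PQ [OF iL] even_sdist_iff [OF B finite_P [OF iL]] eq that by simp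
    then have "even (card B)"
      using even_PQ [OF iL] even_sdist_iff [OF B finite_P [OF iL]] eq by auto
    then show ?thesis using bump_unhit [of I B] un h by (simp add: parity_set_def)
  qed
  have "Suc h \<le> card (Q i)" using i(2) by (simp add: h_def)
  then show ?thesis
    using sdist_least_elems_Suc [OF finite_Q [OF iL]] by (simp add: fA fB sdist_commute)
qed

text \<open>The ends of an edge have different distances to every centre, by parity. If one end lies
  in a ball, so does the nearer one, and the edge leads outwards from it. Outside all balls parity
  alone gives \<open>{}\<close> and \<open>{0}\<close>.\<close>

lemma bump_edge:
  assumes I: "I \<subseteq> {..<L}" and A: "finite A" and B: "finite B" and one: "sdist A B = 1"
  shows "sdist (bump I P Q A) (bump I P Q B) = 1"
proof -
  have par: "odd (card A + card B)" using even_sdist_iff [OF A B] one by simp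
  have diff: "sdist A (P i) \<noteq> sdist B (P i)" if "i < L" for i
    using par even_sdist_iff [OF A finite_P [OF that]] even_sdist_iff [OF B finite_P [OF that]]
    by fastforce
  show ?thesis
  proof (cases "\<exists>i\<in>I. hit i A \<or> hit i B")
    case True
    then obtain i where i: "i \<in> I" "hit i A \<or> hit i B" by blast
    consider "sdist A (P i) < sdist B (P i)" | "sdist B (P i) < sdist A (P i)"
      using diff [of i] i I by fastforce
    then show ?thesis
    proof cases
      case 1
      then show ?thesis using bump_edge_hit [OF I A B one i(1)] i(2) by auto
    next
      case 2
      then show ?thesis
        using bump_edge_hit [OF I B A _ i(1)] one i(2) by (auto simp: sdist_commute)
    qed
  next
    case False
    then show ?thesis
      using par by (auto simp: bump_unhit parity_set_def sdist_def)
  qed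
qed

lemma bump_lipschitz:
  assumes I: "I \<subseteq> {..<L}" and "A \<subseteq> {..<n}" "B \<subseteq> {..<n}"
  shows "sdist (bump I P Q A) (bump I P Q B) \<le> sdist A B"
proof (rule lipschitz_from_edges [OF _ _ assms(2,3)])
  fix A B assume "A \<subseteq> {..<n}" "B \<subseteq> {..<n}" "sdist A B = 1"
  then show "sdist (bump I P Q A) (bump I P Q B) = 1"
    using bump_edge [OF I] by (meson finite_lessThan finite_subset)
qed (simp add: I)

lemma bump_strict:
  assumes "I \<subseteq> {..<L}" "0 < n"
  shows "set_oracle n (bump I P Q) \<in> Strict_Lipschitz_Oracles"
  using assms
  by (intro set_oracle_strict bump_edge bump_sub) (auto intro: finite_subset)

end

section \<open>Codewords\<close>

definition agreement :: "nat \<Rightarrow> (nat \<Rightarrow> nat) \<Rightarrow> (nat \<Rightarrow> nat) \<Rightarrow> nat set" where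
  "agreement q f g = {x. x < q \<and> f x = g x}"

lemma agreement_commute: "agreement q f g = agreement q g f"
  by (auto simp: agreement_def)

text \<open>Such a function is determined by its values outside \<open>M\<close>.\<close>

lemma card_agreeing_on:
  assumes "M \<subseteq> {..<q}" "0 < b"
  shows "card {f \<in> {..<q} \<rightarrow>\<^sub>E {..<b}. \<forall>x\<in>M. f x = g x} \<le> b ^ (q - card M)"
proof -
  let ?S = "{f \<in> {..<q} \<rightarrow>\<^sub>E {..<b::nat}. \<forall>x\<in>M. f x = g x}"
  have "inj_on (\<lambda>f. restrict f ({..<q} - M)) ?S"
  proof (rule inj_onI)
    fix f h assume f: "f \<in> ?S" and h: "h \<in> ?S"
      and eq: "restrict f ({..<q} - M) = restrict h ({..<q} - M)"
    show "f = h"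
    proof (rule PiE_ext)
      show "f \<in> {..<q} \<rightarrow>\<^sub>E {..<b}" "h \<in> {..<q} \<rightarrow>\<^sub>E {..<b}" using f h by auto
      fix x assume "x \<in> {..<q}"
      then show "f x = h x"
        using f h fun_cong [OF eq, of x] by (cases "x \<in> M") auto
    qed
  qed
  moreover have "(\<lambda>f. restrict f ({..<q} - M)) ` ?S \<subseteq> ({..<q} - M) \<rightarrow>\<^sub>E {..<b}"
    by auto
  ultimately have "card ?S \<le> card (({..<q} - M) \<rightarrow>\<^sub>E {..<b})"
    by (intro card_inj_on_le) (auto intro: finite_PiE)
  also have "\<dots> = b ^ (q - card M)"
    using assms by (simp add: card_PiE card_Diff_subset finite_subset)
  finally show ?thesis .
qed

text \<open>A block code of length \<open>q\<close> over an alphabet of size \<open>b\<close> with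
  Hamming distance above \<open>q - m\<close>. The bound is put on agreements because these become
  common elements of the sets encoding the words.\<close>

definition code :: "nat \<Rightarrow> nat \<Rightarrow> nat \<Rightarrow> (nat \<Rightarrow> nat) set \<Rightarrow> bool" where
  "code q b m W \<longleftrightarrow> W \<subseteq> {..<q} \<rightarrow>\<^sub>E {..<b} \<and>
     (\<forall>f\<in>W. \<forall>g\<in>W. f \<noteq> g \<longrightarrow> card (agreement q f g) < m)"

text \<open>A maximal code is large (Gilbert--Varshamov).\<close>

lemma large_code_exists:
  assumes q: "0 < q" and m: "m \<le> q"
  shows "\<exists>W. code q (q * q) m W \<and> q ^ m \<le> card W"
proof -
  let ?b = "q * q"
  let ?F = "{..<q} \<rightarrow>\<^sub>E {..<?b}"
  have finF: "finite ?F" by (intro finite_PiE) auto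
  have fin: "finite {W. code q ?b m W}"
    by (rule finite_subset [of _ "Pow ?F"]) (use finF in \<open>auto simp: code_def\<close>)
  have "code q ?b m {}" by (simp add: code_def)
  then obtain W where W: "code q ?b m W" and max: "\<And>V. code q ?b m V \<Longrightarrow> W \<subseteq> V \<Longrightarrow> V = W"
    using finite_has_maximal [OF fin] by (metis empty_iff mem_Collect_eq)
  have WF: "W \<subseteq> ?F" using W by (simp add: code_def)
  then have finW: "finite W" using finF finite_subset by blast
  define Ms where "Ms = {M. M \<subseteq> {..<q} \<and> card M = m}"
  define S where "S g M = {f \<in> ?F. \<forall>x\<in>M. f x = g x}" for g :: "nat \<Rightarrow> nat" and M
  have finMs: "finite Ms" unfolding Ms_def by (rule finite_subset [of _ "Pow {..<q}"]) auto
  \<comment> \<open>By maximality each function shares at least \<open>m\<close> values with some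
    word, hence all values on some \<open>m\<close>-element set.\<close>
  have cover: "?F \<subseteq> (\<Union>(g, M) \<in> W \<times> Ms. S g M)"
  proof
    fix f assume f: "f \<in> ?F"
    have "\<exists>g\<in>W. m \<le> card (agreement q f g)"
    proof (cases "f \<in> W")
      case True
      have "agreement q f f = {..<q}" by (auto simp: agreement_def)
      then show ?thesis using True m by (intro bexI [of _ f]) auto
    next
      case False
      then have no: "\<not> code q ?b m (insert f W)" using max by blast
      show ?thesis
      proof (rule ccontr)
        assume "\<not> ?thesis"
        then have "\<forall>g\<in>W. card (agreement q f g) < m" by (simp add: not_le)
        then have "code q ?b m (insert f W)"
          using W f by (auto simp: code_def agreement_commute)
        then show False using no by simp
      qed
    qed
    then obtain g where g: "g \<in> W" "m \<le> card (agreement q f g)" by blast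
    then obtain M where M: "M \<subseteq> agreement q f g" "card M = m"
      by (meson obtain_subset_with_card_n)
    then have "M \<in> Ms" "f \<in> S g M" using f by (auto simp: Ms_def S_def agreement_def)
    then show "f \<in> (\<Union>(g, M) \<in> W \<times> Ms. S g M)" using g by (intro UN_I [of "(g, M)"]) auto
  qed
  have "finite (\<Union>(g, M) \<in> W \<times> Ms. S g M)"
    by (rule finite_subset [OF _ finF]) (auto simp: S_def)
  then have "card ?F \<le> card (\<Union>(g, M) \<in> W \<times> Ms. S g M)"
    using cover by (rule card_mono)
  also have "\<dots> \<le> (\<Sum>(g, M) \<in> W \<times> Ms. card (S g M))"
    using finW finMs by (rule_tac order_trans [OF card_UN_le]) (auto simp: case_prod_unfold)
  also have "\<dots> \<le> (\<Sum>(g, M) \<in> W \<times> Ms. ?b ^ (q - m))"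
  proof (rule sum_mono, clarify)
    fix g M assume "M \<in> Ms"
    then show "card (S g M) \<le> ?b ^ (q - m)"
      using card_agreeing_on [of M q ?b g] q by (auto simp: S_def Ms_def)
  qed
  also have "\<dots> = card W * (q choose m) * ?b ^ (q - m)"
    using n_subsets [of "{..<q}" m] by (simp add: Ms_def card_cartesian_product)
  also have "\<dots> \<le> card W * q ^ m * ?b ^ (q - m)"
    using binomial_le_pow [OF m] by simp
  finally have "?b ^ q \<le> card W * q ^ m * ?b ^ (q - m)" by (simp add: card_PiE)
  \<comment> \<open>With an alphabet of size \<open>q * q\<close>, the factor \<open>q ^ m\<close>
    lost to the choice of \<open>M\<close> still leaves \<open>q ^ m\<close> words.\<close>
  also have "?b ^ q = q ^ m * q ^ m * ?b ^ (q - m)"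
    using m by (metis le_add_diff_inverse power_add power_mult_distrib)
  finally have "q ^ m \<le> card W" using q by simp
  then show ?thesis using W by blast
qed

text \<open>
  The element \<open>0\<close> lets all geodesics start with the same step, the element \<open>1\<close> is the bit that
  the relations ask for.
\<close>

definition enc :: "nat \<Rightarrow> (nat \<Rightarrow> nat) \<Rightarrow> nat \<Rightarrow> nat set" where
  "enc b f r = {0, 1} \<union> (\<lambda>x. 2 + (x * b + f x)) ` {..<r}"

lemma mult_add_eq_iff:
  fixes x y b u v :: nat
  assumes "u < b" "v < b"
  shows "x * b + u = y * b + v \<longleftrightarrow> x = y \<and> u = v"
proof
  assume eq: "x * b + u = y * b + v"
  have "(x * b + u) div b = x" "(y * b + v) div b = y" using assms by simp_all
  then have "x = y" using eq by simp
  then show "x = y \<and> u = v" using eq by simp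
qed simp

lemma finite_enc [simp]: "finite (enc b f r)"
  by (simp add: enc_def)

lemma card_enc:
  assumes "f \<in> {..<q} \<rightarrow>\<^sub>E {..<b}" "r \<le> q"
  shows "card (enc b f r) = r + 2"
proof -
  have "inj_on (\<lambda>x. 2 + (x * b + f x)) {..<r}"
    using assms by (auto intro!: inj_onI simp: mult_add_eq_iff PiE_iff)
  then have "card ((\<lambda>x. 2 + (x * b + f x)) ` {..<r}) = r"
    by (simp add: card_image)
  moreover have "card (enc b f r) = card {0, 1::nat} + card ((\<lambda>x. 2 + (x * b + f x)) ` {..<r})"
    unfolding enc_def by (intro card_Un_disjoint) auto
  ultimately show ?thesis by simp
qed

lemma enc_sub:
  assumes "f \<in> {..<q} \<rightarrow>\<^sub>E {..<b}" "r \<le> q"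
  shows "enc b f r \<subseteq> {..<q * b + 2}"
proof -
  have "x * b + f x < q * b" if "x < r" for x
  proof -
    have "f x < b" using assms that by (auto simp: PiE_iff)
    then have "x * b + f x < Suc x * b" by simp
    also have "\<dots> \<le> q * b" using that assms by (intro mult_right_mono) auto
    finally show ?thesis .
  qed
  then show ?thesis by (auto simp: enc_def)
qed

text \<open>The sets share at most \<open>0\<close>, \<open>1\<close> and one element per agreement,
  and there are fewer than \<open>m\<close> agreements.\<close>

lemma sdist_enc:
  assumes W: "code q b m W" and f: "f \<in> W" and g: "g \<in> W" and "f \<noteq> g"
    and r: "r \<le> q" "s \<le> q"
  shows "r + s + 4 \<le> sdist (enc b f r) (enc b g s) + 2 * (m + 1)"
proof -
  have fg: "f \<in> {..<q} \<rightarrow>\<^sub>E {..<b}" "g \<in> {..<q} \<rightarrow>\<^sub>E {..<b}" using W f g by (auto simp: code_def)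
  have "enc b f r \<inter> enc b g s \<subseteq> {0, 1} \<union> (\<lambda>x. 2 + (x * b + f x)) ` agreement q f g"
    using fg r by (auto simp: enc_def agreement_def mult_add_eq_iff PiE_iff)
  then have "card (enc b f r \<inter> enc b g s)
      \<le> card ({0, 1} \<union> (\<lambda>x. 2 + (x * b + f x)) ` agreement q f g)"
    by (intro card_mono) (auto simp: agreement_def)
  also have "\<dots> \<le> card {0, 1::nat} + card ((\<lambda>x. 2 + (x * b + f x)) ` agreement q f g)"
    by (rule card_Un_le)
  also have "\<dots> \<le> 2 + card (agreement q f g)"
    by (auto intro!: card_image_le simp: agreement_def)
  also have "\<dots> \<le> m + 1" using W f g \<open>f \<noteq> g\<close> by (simp add: code_def Suc_leI)
  finally show ?thesis
    using sdist_add_card_Int [of "enc b f r" "enc b g s"] card_enc fg r by simp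
qed

text \<open>The effect of copying bit \<open>p div 5\<close> to position \<open>p\<close>. Weights
  and distances grow fivefold; a factor above four lets centres made from words of weight
  \<open>w\<close> with small overlaps keep distance \<open>8 * w\<close>, twice the radius
  \<open>4 * w\<close> used in the token count.\<close>

definition dup :: "nat set \<Rightarrow> nat set" where
  "dup A = {p. p div 5 \<in> A}"

lemma dup_eq: "dup A = (\<lambda>(a, r). a * 5 + r) ` (A \<times> {..<5})"
proof -
  have "p \<in> (\<lambda>(a, r). a * 5 + r) ` (A \<times> {..<5})" if "p div 5 \<in> A" for p :: nat
    using that by (intro image_eqI [of _ _ "(p div 5, p mod 5)"]) auto
  then show ?thesis by (auto simp: dup_def)
qed

lemma finite_dup: "finite A \<Longrightarrow> finite (dup A)"
  by (simp add: dup_eq)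

lemma card_dup: "card (dup A) = 5 * card A"
proof -
  have "inj_on (\<lambda>(a, r). a * 5 + r) (A \<times> {..<5::nat})"
    by (auto intro!: inj_onI simp: mult_add_eq_iff)
  then show ?thesis by (simp add: dup_eq card_image card_cartesian_product)
qed

lemma sdist_dup: "sdist (dup A) (dup B) = 5 * sdist A B"
proof -
  have "(dup A - dup B) \<union> (dup B - dup A) = dup ((A - B) \<union> (B - A))" by (auto simp: dup_def)
  then show ?thesis by (simp add: sdist_def card_dup)
qed

lemma dup_sub: "A \<subseteq> {..<k} \<Longrightarrow> 5 * k \<le> n \<Longrightarrow> dup A \<subseteq> {..<n}"
  by (force simp: dup_def)

lemma bits_dup:
  assumes "A \<subseteq> {..<n}"
  shows "map (\<lambda>p. bits n A ! (p div 5)) [0..<n] = bits n (dup A)"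
  by (rule nth_equalityI) (auto simp: dup_def intro: le_less_trans [OF div_le_dividend])

text \<open>The forbidden elements for \<open>f j\<close> may depend on \<open>f 0, \<dots>, f (j - 1)\<close>.\<close>

lemma greedy_choice:
  fixes Bad :: "nat \<Rightarrow> (nat \<Rightarrow> 'c) \<Rightarrow> 'c set"
  assumes ex: "\<And>j f. j \<le> L \<Longrightarrow> (\<And>i. i < j \<Longrightarrow> f i \<in> W) \<Longrightarrow> \<exists>c\<in>W. c \<notin> Bad j f"
    and local: "\<And>j f g. (\<And>i. i < j \<Longrightarrow> f i = g i) \<Longrightarrow> Bad j f = Bad j g"
  shows "\<exists>f. \<forall>j\<le>L. f j \<in> W \<and> f j \<notin> Bad j f"
proof -
  have "\<exists>f. \<forall>j<k. f j \<in> W \<and> f j \<notin> Bad j f" if "k \<le> Suc L" for k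
    using that
  proof (induction k)
    case (Suc k)
    then obtain f where f: "\<And>j. j < k \<Longrightarrow> f j \<in> W \<and> f j \<notin> Bad j f" by auto
    then obtain c where c: "c \<in> W" "c \<notin> Bad k f" using ex [of k f] Suc.prems by auto
    have "Bad j (f(k := c)) = Bad j f" if "j \<le> k" for j
      using that by (intro local) auto
    then have "\<forall>j<Suc k. (f(k := c)) j \<in> W \<and> (f(k := c)) j \<notin> Bad j (f(k := c))"
      using f c by (auto simp: less_Suc_eq)
    then show ?case by blast
  qed simp
  from this [of "Suc L"] show ?thesis by (auto simp: less_Suc_eq_le)
qed

section \<open>Queries of circuits\<close>

fun cqueries :: "oracle_fun \<Rightarrow> bool list \<Rightarrow> cgate list \<Rightarrow> bool list list" where
  "cqueries \<alpha> v [] = []"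
| "cqueries \<alpha> v (COracle is os # gs) =
     map ((!) v) is # cqueries \<alpha> (cgate_step \<alpha> (COracle is os) v) gs"
| "cqueries \<alpha> v (g # gs) = cqueries \<alpha> (cgate_step \<alpha> g v) gs"

lemma length_cqueries: "length (cqueries \<alpha> v gs) \<le> length gs"
  by (induction \<alpha> v gs rule: cqueries.induct) auto

text \<open>Agreement is assumed only on the queries of the run with \<alpha>. Both runs start in
  the same state and every answer coincides, so the run with \<beta> asks the same queries.\<close>

lemma cqueries_agree:
  assumes "\<And>A. A \<in> set (cqueries \<alpha> v gs) \<Longrightarrow> \<alpha> A = \<beta> A"
  shows "cqueries \<beta> v gs = cqueries \<alpha> v gs"
    and "fold (cgate_step \<beta>) gs v = fold (cgate_step \<alpha>) gs v"
  using assms by (induction \<alpha> v gs rule: cqueries.induct) auto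

section \<open>Differing wires in two runs of a comparator circuit\<close>

lemma length_place [simp]: "length (place ws bs v) = length v"
  by (induction ws arbitrary: bs v) (auto simp: place_def zip_Cons1 split: list.splits)

lemma place_Cons: "place (w # ws) (b # bs) v = place ws bs (v[w := b])"
  by (simp add: place_def)

lemma place_notin: "length ws = length bs \<Longrightarrow> i \<notin> set ws \<Longrightarrow> place ws bs v ! i = v ! i"
proof (induction ws bs arbitrary: v rule: list_induct2)
  case Nil
  then show ?case by (simp add: place_def)
qed (simp add: place_Cons)

lemma place_in:
  assumes "length ws = length bs" "distinct ws" "set ws \<subseteq> {..<length v}" "p < length ws"
  shows "place ws bs v ! (ws ! p) = bs ! p"
  using assms
proof (induction ws bs arbitrary: v p rule: list_induct2)
  case (Cons w ws b bs)
  then show ?case by (cases p) (auto simp: place_Cons place_notin)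
qed simp

lemma length_cgate_step [simp]: "length (cgate_step \<alpha> g v) = length v"
  by (cases g) auto

lemma hamming_sum: "hamming X Y = (\<Sum>i<length X. of_bool (X ! i \<noteq> Y ! i))"
proof -
  have "hamming X Y = (\<Sum>i\<in>{i. i < length X \<and> X ! i \<noteq> Y ! i}. 1)"
    unfolding hamming_def by simp
  also have "\<dots> = (\<Sum>i<length X. of_bool (X ! i \<noteq> Y ! i))"
    by (rule sum.mono_neutral_cong_left) auto
  finally show ?thesis .
qed

lemma hamming_split:
  assumes "S \<subseteq> {..<length X}"
  shows "hamming X Y = (\<Sum>i\<in>{..<length X} - S. of_bool (X ! i \<noteq> Y ! i))
    + (\<Sum>i\<in>S. of_bool (X ! i \<noteq> Y ! i))"
  unfolding hamming_sum using assms by (rule sum.subset_diff) simp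

lemma sum_nth_differ:
  assumes "distinct ws"
  shows "(\<Sum>i\<in>set ws. of_bool (v ! i \<noteq> v' ! i))
    = hamming (map ((!) v) ws) (map ((!) v') ws)"
proof -
  have "(\<Sum>p<length ws. of_bool (v ! (ws ! p) \<noteq> v' ! (ws ! p)))
      = (\<Sum>i\<in>set ws. of_bool (v ! i \<noteq> v' ! i) :: nat)"
    using bij_betw_nth [OF assms refl refl]
    by (rule sum.reindex_bij_betw [where g = "\<lambda>i. of_bool (v ! i \<noteq> v' ! i)"])
  then show ?thesis by (simp add: hamming_sum)
qed

text \<open>A comparator sorts two bits, and sorting two pairs of bits cannot increase the number of
  places where they differ.\<close>

lemma hamming_comparator:
  assumes "i < length v" "j < length v" "i \<noteq> j" "length v' = length v"
  shows "hamming (cgate_step \<alpha> (Comparator i j) v) (cgate_step \<beta> (Comparator i j) v')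
    \<le> hamming v v'"
proof -
  let ?r = "cgate_step \<alpha> (Comparator i j) v" and ?r' = "cgate_step \<beta> (Comparator i j) v'"
  have "(\<Sum>k\<in>{..<length v} - {i, j}. of_bool (?r ! k \<noteq> ?r' ! k))
      = (\<Sum>k\<in>{..<length v} - {i, j}. of_bool (v ! k \<noteq> v' ! k) :: nat)"
    by (rule sum.cong) auto
  moreover have "(\<Sum>k\<in>{i, j}. of_bool (?r ! k \<noteq> ?r' ! k))
      \<le> (\<Sum>k\<in>{i, j}. of_bool (v ! k \<noteq> v' ! k) :: nat)"
    using assms by (cases "v ! i"; cases "v ! j"; cases "v' ! i"; cases "v' ! j")
      (simp_all add: nth_list_update del: sum_of_bool_eq)
  ultimately show ?thesis
    using hamming_split [of "{i, j}" ?r ?r'] hamming_split [of "{i, j}" v v'] assms by simp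
qed

lemma hamming_not:
  assumes "i < length v" "length v' = length v"
  shows "hamming (cgate_step \<alpha> (CNot i) v) (cgate_step \<beta> (CNot i) v') \<le> hamming v v'"
  unfolding hamming_def using assms
  by (intro card_mono) (auto simp: nth_list_update split: if_splits)

text \<open>Zeroing the input wires removes the differences on them, and the outputs bring in those
  between the two answers. Differences on overwritten wires are lost, whence the inequality. The sum
  form avoids subtraction on \<open>nat\<close>.\<close>

lemma hamming_oracle:
  assumes wf: "wf_cgate n (length v) (COracle is os)" and len: "length v' = length v"
    and lenA: "length (\<alpha> (map ((!) v) is)) = n" and lenB: "length (\<beta> (map ((!) v') is)) = n"
  shows "hamming (cgate_step \<alpha> (COracle is os) v) (cgate_step \<beta> (COracle is os) v')
      + hamming (map ((!) v) is) (map ((!) v') is)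
    \<le> hamming v v' + hamming (\<alpha> (map ((!) v) is)) (\<beta> (map ((!) v') is))"
proof -
  let ?A = "map ((!) v) is" and ?B = "map ((!) v') is" and ?z = "replicate n False"
  define u where "u = place is ?z v"
  define u' where "u' = place is ?z v'"
  define r where "r = place os (\<alpha> ?A) u"
  define r' where "r' = place os (\<beta> ?B) u'"
  have w: "length is = n" "length os = n" "distinct is" "distinct os"
    "set is \<subseteq> {..<length v}" "set os \<subseteq> {..<length v}"
    using wf by auto
  have len': "length u = length v" "length u' = length v" "length r = length v"
    "length r' = length v"
    using len by (simp_all add: u_def u'_def r_def r'_def)
  have out: "map ((!) r) os = \<alpha> ?A" "map ((!) r') os = \<beta> ?B"
    using w lenA lenB len len'
    by (auto intro!: nth_equalityI simp: r_def r'_def place_in)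
  have z: "u ! i = False" "u' ! i = False" if i: "i \<in> set is" for i
  proof -
    obtain p where p: "p < length is" "i = is ! p" using i by (auto simp: in_set_conv_nth)
    then show "u ! i = False" "u' ! i = False"
      using place_in [of "is" ?z v p] place_in [of "is" ?z v' p] w len
      by (simp_all add: u_def u'_def)
  qed
  have "hamming r r' = (\<Sum>i\<in>{..<length v} - set os. of_bool (r ! i \<noteq> r' ! i))
      + hamming (\<alpha> ?A) (\<beta> ?B)"
    using hamming_split [of "set os" r r'] sum_nth_differ [OF w(4), of r r'] out len' w
    by simp
  also have "(\<Sum>i\<in>{..<length v} - set os. of_bool (r ! i \<noteq> r' ! i))
      = (\<Sum>i\<in>{..<length v} - set os. of_bool (u ! i \<noteq> u' ! i) :: nat)"
    using w lenA lenB by (intro sum.cong) (auto simp: r_def r'_def place_notin)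
  also have "\<dots> \<le> (\<Sum>i<length v. of_bool (u ! i \<noteq> u' ! i))"
    by (rule sum_mono2) auto
  also have "\<dots> = hamming u u'" using len' by (simp add: hamming_sum)
  also have "\<dots> = (\<Sum>i\<in>{..<length v} - set is. of_bool (u ! i \<noteq> u' ! i))
      + (\<Sum>i\<in>set is. of_bool (u ! i \<noteq> u' ! i))"
    using hamming_split [of "set is" u u'] w len' by simp
  also have "(\<Sum>i\<in>{..<length v} - set is. of_bool (u ! i \<noteq> u' ! i))
      = (\<Sum>i\<in>{..<length v} - set is. of_bool (v ! i \<noteq> v' ! i) :: nat)"
    using w by (intro sum.cong) (auto simp: u_def u'_def place_notin)
  also have "(\<Sum>i\<in>set is. of_bool (u ! i \<noteq> u' ! i)) = (0::nat)"
    using z by simp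
  finally have "hamming r r' \<le> (\<Sum>i\<in>{..<length v} - set is. of_bool (v ! i \<noteq> v' ! i))
      + hamming (\<alpha> ?A) (\<beta> ?B)" by simp
  moreover have "hamming v v'
      = (\<Sum>i\<in>{..<length v} - set is. of_bool (v ! i \<noteq> v' ! i)) + hamming ?A ?B"
    using hamming_split [of "set is" v v'] sum_nth_differ [OF w(3), of v v'] w by simp
  ultimately have "hamming r r' + hamming ?A ?B \<le> hamming v v' + hamming (\<alpha> ?A) (\<beta> ?B)"
    by simp
  then show ?thesis using w by (simp add: r_def r'_def u_def u'_def)
qed

text \<open>
  A query \<open>A\<close> of the first run creates \<open>c\<close> tokens if \<open>Z A\<close>, and destroys \<open>c'\<close> tokens if \<open>Z' A\<close>.
\<close>

lemma token_count:
  assumes "\<forall>g\<in>set gs. wf_cgate n (length v) g" "length v' = length v"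
    and "length_preserving \<alpha>" "length_preserving \<beta>"
    and "\<And>A B. length A = n \<Longrightarrow> length B = n \<Longrightarrow> B \<in> set (cqueries \<beta> v' gs) \<Longrightarrow>
      hamming (\<alpha> A) (\<beta> B) + of_bool (Z' A) * c' \<le> hamming A B + of_bool (Z A) * c"
  shows "length (filter Z' (cqueries \<alpha> v gs)) * c'
    \<le> hamming v v' + length (filter Z (cqueries \<alpha> v gs)) * c"
  using assms
proof (induction gs arbitrary: v v')
  case (Cons g gs)
  let ?v = "cgate_step \<alpha> g v" and ?v' = "cgate_step \<beta> g v'"
  have sub: "set (cqueries \<beta> ?v' gs) \<subseteq> set (cqueries \<beta> v' (g # gs))"
    by (cases g) auto
  have IH: "length (filter Z' (cqueries \<alpha> ?v gs)) * c'
      \<le> hamming ?v ?v' + length (filter Z (cqueries \<alpha> ?v gs)) * c"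
  proof (rule Cons.IH)
    fix A B :: "bool list" assume "length A = n" "length B = n" "B \<in> set (cqueries \<beta> ?v' gs)"
    then show "hamming (\<alpha> A) (\<beta> B) + of_bool (Z' A) * c' \<le> hamming A B + of_bool (Z A) * c"
      using sub by (intro Cons.prems(5)) auto
  qed (use Cons.prems in auto)
  show ?case
  proof (cases g)
    case (Comparator i j)
    then show ?thesis
      using IH hamming_comparator [of i v j v' \<alpha> \<beta>] Cons.prems(1,2) by auto
  next
    case (CNot i)
    then show ?thesis
      using IH hamming_not [of i v v' \<alpha> \<beta>] Cons.prems(1,2) by auto
  next
    case (COracle "is" os)
    let ?A = "map ((!) v) is" and ?B = "map ((!) v') is"
    have wf: "wf_cgate n (length v) (COracle is os)" using Cons.prems(1) COracle by simp
    then have len: "length ?A = n" "length ?B = n" by auto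
    have "length (\<alpha> ?A) = n" "length (\<beta> ?B) = n"
      using len Cons.prems(3,4) by (simp_all add: length_preserving_def)
    then have "hamming ?v ?v' + hamming ?A ?B \<le> hamming v v' + hamming (\<alpha> ?A) (\<beta> ?B)"
      using hamming_oracle [OF wf] Cons.prems(2) COracle by simp
    moreover have "hamming (\<alpha> ?A) (\<beta> ?B) + of_bool (Z' ?A) * c'
        \<le> hamming ?A ?B + of_bool (Z ?A) * c"
      using Cons.prems(5) [OF len] COracle by simp
    ultimately have "hamming ?v ?v' + of_bool (Z' ?A) * c' \<le> hamming v v' + of_bool (Z ?A) * c"
      by simp
    then show ?thesis using IH COracle by (auto split: if_splits)
  qed
qed simp

section \<open>Evaluation and nesting depth in Boolean circuits\<close>

definition bvals :: "oracle_fun \<Rightarrow> bool list \<Rightarrow> bgate list \<Rightarrow> bool list list" where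
  "bvals \<alpha> X gs = foldl (\<lambda>vs g. vs @ [bgate_val \<alpha> X vs g]) [] gs"

lemma bvals_snoc: "bvals \<alpha> X (gs @ [g]) = bvals \<alpha> X gs @ [bgate_val \<alpha> X (bvals \<alpha> X gs) g]"
  by (simp add: bvals_def)

lemma bvals_Nil [simp]: "bvals \<alpha> X [] = []"
  by (simp add: bvals_def)

lemma length_bvals [simp]: "length (bvals \<alpha> X gs) = length gs"
  by (induction gs rule: rev_induct) (simp_all add: bvals_snoc)

lemma nth_bvals: "k < length gs \<Longrightarrow> bvals \<alpha> X gs ! k = bgate_val \<alpha> X (bvals \<alpha> X (take k gs)) (gs ! k)"
proof (induction gs rule: rev_induct)
  case (snoc g gs)
  then show ?case by (cases "k < length gs") (auto simp: bvals_snoc nth_append)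
qed simp

lemma take_bvals: "k \<le> length gs \<Longrightarrow> bvals \<alpha> X (take k gs) = take k (bvals \<alpha> X gs)"
proof (induction gs rule: rev_induct)
  case (snoc g gs)
  then show ?case by (cases "k \<le> length gs") (auto simp: bvals_snoc)
qed simp

lemma gate_depths_snoc:
  "gate_depths w (gs @ [g]) = gate_depths w gs @
    [of_bool (w g) + Max (insert 0 (source_depth (gate_depths w gs) ` set (sources g)))]"
  by (simp add: gate_depths_def)

lemma length_gate_depths [simp]: "length (gate_depths w gs) = length gs"
  by (induction gs rule: rev_induct) (simp_all add: gate_depths_snoc, simp add: gate_depths_def)

lemma nth_gate_depths: "k < length gs \<Longrightarrow> gate_depths w gs ! k =
    of_bool (w (gs ! k)) +
    Max (insert 0 (source_depth (gate_depths w (take k gs)) ` set (sources (gs ! k))))"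
proof (induction gs rule: rev_induct)
  case (snoc g gs)
  then show ?case by (cases "k < length gs") (auto simp: gate_depths_snoc nth_append)
qed simp

lemma take_gate_depths: "k \<le> length gs \<Longrightarrow> gate_depths w (take k gs) = take k (gate_depths w gs)"
proof (induction gs rule: rev_induct)
  case (snoc g gs)
  then show ?case by (cases "k \<le> length gs") (auto simp: gate_depths_snoc)
qed (simp add: gate_depths_def)

text \<open>Formed for gates of every kind, so that one congruence argument covers Boolean and
  oracle gates.\<close>

definition bquery :: "oracle_fun \<Rightarrow> bool list \<Rightarrow> bgate list \<Rightarrow> nat \<Rightarrow> bool list" where
  "bquery \<alpha> X gs k = map (source_val X (bvals \<alpha> X gs)) (sources (gs ! k))"

definition wf_bgates :: "nat \<Rightarrow> bgate list \<Rightarrow> bool" where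
  "wf_bgates n gs \<longleftrightarrow> (\<forall>k < length gs. \<forall>s \<in> set (sources (gs ! k)). wf_source n (take k gs) s)"

lemma source_val_take:
  assumes "wf_source n (take k gs) s" "k \<le> length gs"
  shows "source_val X (take k (bvals \<alpha> X gs)) s = source_val X (bvals \<alpha> X gs) s"
  using assms by (cases s) auto

lemma source_depth_take:
  assumes "wf_source n (take k gs) s" "k \<le> length gs"
  shows "source_depth (take k (gate_depths w gs)) s = source_depth (gate_depths w gs) s"
  using assms by (cases s) auto

text \<open>Well-formedness makes the sources of gate \<open>k\<close> refer to earlier gates only,
  so they may be read off the complete list of values instead of its prefix.\<close>

lemma nth_bvals_query:
  assumes wf: "wf_bgates n gs" and k: "k < length gs"
  shows "bvals \<alpha> X gs ! k = (case gs ! k of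
      BNot s \<Rightarrow> [\<not> hd (bquery \<alpha> X gs k)]
    | BAnd s t \<Rightarrow> [bquery \<alpha> X gs k ! 0 \<and> bquery \<alpha> X gs k ! 1]
    | BOr s t \<Rightarrow> [bquery \<alpha> X gs k ! 0 \<or> bquery \<alpha> X gs k ! 1]
    | BOracle ss \<Rightarrow> \<alpha> (bquery \<alpha> X gs k))"
proof -
  have "bquery \<alpha> X gs k = map (source_val X (take k (bvals \<alpha> X gs))) (sources (gs ! k))"
    unfolding bquery_def
    using wf k by (intro map_cong refl source_val_take [of n, symmetric]) (auto simp: wf_bgates_def)
  then show ?thesis
    using nth_bvals [OF k, of \<alpha> X] take_bvals [of k gs \<alpha> X] k
    by (simp split: bgate.splits)
qed

lemma source_depth_le:
  assumes wf: "wf_bgates n gs" and k: "k < length gs" and s: "s \<in> set (sources (gs ! k))"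
  shows "of_bool (w (gs ! k)) + source_depth (gate_depths w gs) s \<le> gate_depths w gs ! k"
proof -
  have "source_depth (gate_depths w gs) s = source_depth (take k (gate_depths w gs)) s"
    using wf k s source_depth_take [of n k gs s w] by (auto simp: wf_bgates_def)
  also have "\<dots> \<le> Max (insert 0 (source_depth (take k (gate_depths w gs)) ` set (sources (gs ! k))))"
    using s by (intro Max_ge) auto
  finally show ?thesis using nth_gate_depths [OF k, of w] take_gate_depths [of k gs w] k by simp
qed

text \<open>Values at nesting depth up to \<open>d\<close> depend only on answers up to that depth.
  An oracle gate at depth \<open>d + 1\<close> reads sources of depth at most \<open>d\<close>, so
  its query, though not yet its answer, is determined as well.\<close>

lemma bquery_agree:
  assumes wf: "wf_bgates n gs"
    and agree: "\<And>k. k < length gs \<Longrightarrow> is_oracle (gs ! k) \<Longrightarrow> gate_depths is_oracle gs ! k \<le> d \<Longrightarrow>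
      \<alpha> (bquery \<alpha> X gs k) = \<beta> (bquery \<alpha> X gs k)"
  shows "k < length gs \<Longrightarrow> gate_depths is_oracle gs ! k \<le> d \<Longrightarrow>
      bvals \<beta> X gs ! k = bvals \<alpha> X gs ! k"
    and "k < length gs \<Longrightarrow> is_oracle (gs ! k) \<Longrightarrow> gate_depths is_oracle gs ! k \<le> Suc d \<Longrightarrow>
      bquery \<beta> X gs k = bquery \<alpha> X gs k"
proof -
  have src: "source_val X (bvals \<beta> X gs) s = source_val X (bvals \<alpha> X gs) s"
    if "\<And>j. j < k \<Longrightarrow> gate_depths is_oracle gs ! j \<le> d \<Longrightarrow> bvals \<beta> X gs ! j = bvals \<alpha> X gs ! j"
      and k: "k < length gs" and s: "s \<in> set (sources (gs ! k))"
      and d: "gate_depths is_oracle gs ! k \<le> of_bool (is_oracle (gs ! k)) + d" for s k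
  proof (cases s)
    case (SGate j p)
    have "wf_source n (take k gs) s" using wf k s by (auto simp: wf_bgates_def)
    then show ?thesis
      using SGate that(1) [of j] source_depth_le [OF wf k s, of is_oracle] d by simp
  qed auto
  have vals: "bvals \<beta> X gs ! k = bvals \<alpha> X gs ! k"
    if "k < length gs" "gate_depths is_oracle gs ! k \<le> d" for k
    using that
  proof (induction k rule: less_induct)
    case (less k)
    have "bquery \<beta> X gs k = bquery \<alpha> X gs k"
      unfolding bquery_def using less by (intro map_cong refl src) auto
    then show ?case
      using nth_bvals_query [OF wf less.prems(1), of \<alpha> X]
        nth_bvals_query [OF wf less.prems(1), of \<beta> X] agree [of k] less.prems
      by (auto split: bgate.splits)
  qed
  show "k < length gs \<Longrightarrow> gate_depths is_oracle gs ! k \<le> d \<Longrightarrow>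
      bvals \<beta> X gs ! k = bvals \<alpha> X gs ! k" by (rule vals)
  show "k < length gs \<Longrightarrow> is_oracle (gs ! k) \<Longrightarrow> gate_depths is_oracle gs ! k \<le> Suc d \<Longrightarrow>
      bquery \<beta> X gs k = bquery \<alpha> X gs k"
    unfolding bquery_def using vals by (intro map_cong refl src) auto
qed

lemma gate_depths_le_max_path: "k < length gs \<Longrightarrow> gate_depths w gs ! k \<le> max_path w gs"
  unfolding max_path_def by (intro Max_ge) auto

lemma beval_bvals: "beval \<alpha> X C = source_val X (bvals \<alpha> X (bgates C)) (bout C)"
  by (simp add: beval_def bvals_def)

section \<open>The circuits for the two relations\<close>

text \<open>
  The lower bound needs more iterations than any power of \<open>log n\<close>, but few enough for the
  codewords, of weight about \<open>n\<^bsup>1/4\<^esup>\<close>, to lose a constant weight in each of them.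
\<close>

definition iter_count :: "nat \<Rightarrow> nat" where
  "iter_count n = floor_sqrt (floor_sqrt (floor_sqrt n))"

text \<open>Expresses the number of gates by a polynomial inequality, the form that a first-order
  description can use.\<close>

lemma less_iter_count_iff: "k < iter_count n \<longleftrightarrow> (k + 1) ^ 8 \<le> n"
proof -
  have "k < iter_count n \<longleftrightarrow> k + 1 \<le> iter_count n" by auto
  also have "\<dots> \<longleftrightarrow> (((k + 1)\<^sup>2)\<^sup>2)\<^sup>2 \<le> n"
    by (simp only: iter_count_def le_floor_sqrt_iff)
  also have "(((k + 1)\<^sup>2)\<^sup>2)\<^sup>2 = (k + 1) ^ 8"
    by (simp only: power_mult [symmetric]) simp
  finally show ?thesis .
qed

lemma iter_count_power8: "iter_count (t ^ 8) = t"
proof -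
  have "t ^ 8 = ((t\<^sup>2)\<^sup>2)\<^sup>2" by (simp only: power_mult [symmetric]) simp
  then show ?thesis by (simp only: iter_count_def floor_sqrt_inverse_power2)
qed

lemma iter_count_le: "iter_count n \<le> n"
  unfolding iter_count_def by (meson floor_sqrt_le order_trans)

text \<open>The two constant wires make wire \<open>1\<close> exist for every \<open>n\<close>, also
  below two.\<close>

definition iter_circuit :: "nat \<Rightarrow> ccircuit" where
  "iter_circuit n = \<lparr>annotations = map APos [0..<n] @ [AConst False, AConst False],
     cgates = replicate (iter_count n) (COracle [0..<n] [0..<n]), cout = 1\<rparr>"

lemma place_upt:
  assumes "length bs = n" "length v = n"
  shows "place [0..<n] bs (v @ u) = bs @ u"
proof (rule nth_equalityI)
  fix i assume "i < length (place [0..<n] bs (v @ u))"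
  moreover have "{0..<n} \<subseteq> {..<n + length u}" by auto
  ultimately show "place [0..<n] bs (v @ u) ! i = (bs @ u) ! i"
    using assms place_in [of "[0..<n]" bs "v @ u" i] place_notin [of "[0..<n]" bs i "v @ u"]
    by (cases "i < n") (auto simp: nth_append)
qed (use assms in simp)

lemma fold_iter_gates:
  assumes "length_preserving \<alpha>" "length v = n"
  shows "fold (cgate_step \<alpha>) (replicate k (COracle [0..<n] [0..<n])) (v @ u) = (\<alpha> ^^ k) v @ u"
  using assms(2)
proof (induction k arbitrary: v)
  case (Suc k)
  have "map ((!) (v @ u)) [0..<n] = v"
    using Suc.prems by (auto intro!: nth_equalityI simp: nth_append)
  moreover have "length (\<alpha> v) = n"
    using assms(1) Suc.prems by (simp add: length_preserving_def)
  ultimately have "cgate_step \<alpha> (COracle [0..<n] [0..<n]) (v @ u) = \<alpha> v @ u"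
    using Suc.prems by (simp add: place_upt)
  then show ?case
    using Suc.IH [of "\<alpha> v"] \<open>length (\<alpha> v) = n\<close> by (simp add: funpow_swap1)
qed simp

lemma ceval_iter_circuit:
  assumes "length_preserving \<alpha>" "2 \<le> length X"
  shows "ceval \<alpha> X (iter_circuit (length X)) = (\<alpha> ^^ iter_count (length X)) X ! 1"
proof -
  have "length ((\<alpha> ^^ k) X) = length X" for k
    using assms(1) by (induction k) (auto simp: length_preserving_def)
  moreover have "map (annotation_val X) (annotations (iter_circuit (length X)))
      = X @ [False, False]"
    by (auto simp: iter_circuit_def intro!: nth_equalityI simp: nth_append)
  ultimately show ?thesis
    using assms fold_iter_gates [OF assms(1) refl, of "iter_count (length X)" X "[False, False]"]
    by (simp add: ceval_def) (simp add: iter_circuit_def nth_append)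
qed

text \<open>Brings the description into the shape of a formula over \<open>n\<close> and the five
  entries, which \<open>iter_circuit_uniform\<close> then spells out.\<close>

lemma iter_desc_iff:
  "[a, b, c, d, e] \<in> ccircuit_desc (iter_circuit n) \<longleftrightarrow>
     a = 0 \<and> b = 0 \<and> c = 0 \<and> d = 0 \<and> e = 1 \<or>
     a = 1 \<and> c = 0 \<and> (b < n \<and> d = 1 \<and> e = b \<or> (b = n \<or> b = n + 1) \<and> d = 0 \<and> e = 0) \<or>
     a = 2 \<and> (b + 1) ^ 8 \<le> n \<and>
       (c = 2 \<and> d = 0 \<and> e = 0 \<or> (c = 3 \<or> c = 4) \<and> d = e \<and> d < n)"
proof -
  have ann: "(\<exists>i < n + 2. [a, b, c, d, e] = [1, i, 0] @
        annotation_code ((map APos [0..<n] @ [AConst False, AConst False]) ! i)) \<longleftrightarrow>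
      a = 1 \<and> c = 0 \<and> (b < n \<and> d = 1 \<and> e = b \<or> (b = n \<or> b = n + 1) \<and> d = 0 \<and> e = 0)"
    (is "?l \<longleftrightarrow> ?r")
  proof
    assume ?l
    then obtain i where i: "i < n + 2" and eq: "[a, b, c, d, e] = [1, i, 0] @
        annotation_code ((map APos [0..<n] @ [AConst False, AConst False]) ! i)" by blast
    consider "i < n" | "i = n" | "i = n + 1" using i by linarith
    then show ?r
    proof cases
      case 1
      then show ?thesis using eq by (simp add: nth_append)
    next
      case 2
      then show ?thesis using eq by (simp add: nth_append)
    next
      case 3
      then show ?thesis using eq by (simp add: nth_append)
    qed
  next
    assume ?r
    then show ?l by (intro exI [of _ b]) (auto simp: nth_append)
  qed
  have gate: "[a, b, c, d, e] \<in> {[2, k] @ x | k x. k < iter_count n \<and>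
        x \<in> cgate_desc (replicate (iter_count n) (COracle [0..<n] [0..<n]) ! k)} \<longleftrightarrow>
      a = 2 \<and> (b + 1) ^ 8 \<le> n \<and>
        (c = 2 \<and> d = 0 \<and> e = 0 \<or> (c = 3 \<or> c = 4) \<and> d = e \<and> d < n)"
    unfolding less_iter_count_iff [symmetric] by auto
  show ?thesis
    unfolding ccircuit_desc_def using ann gate by (auto simp: iter_circuit_def)
qed

section \<open>Uniformity and size of the iteration circuits\<close>

definition Disj :: "fm \<Rightarrow> fm \<Rightarrow> fm" where
  "Disj f g = Neg (Conj (Neg f) (Neg g))"

lemma sat_Disj [simp]: "sat e (Disj f g) \<longleftrightarrow> sat e f \<or> sat e g"
  by (simp add: Disj_def)

text \<open>\<open>Var 0\<close> is the index of the circuit, and \<open>Var 1\<close> to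
  \<open>Var k\<close> are the entries of the tuple.\<close>

lemma AC0_uniform_I:
  assumes "\<And>x xs. length xs = k \<Longrightarrow>
    xs \<in> D x \<longleftrightarrow> sat (\<lambda>i. if i < Suc k then (x # xs) ! i else 0) f"
  shows "AC0_uniform k D"
  unfolding AC0_uniform_def AC0_relation_def
proof (intro exI [of _ f] allI impI)
  fix xs :: "nat list" assume "length xs = Suc k"
  then obtain y ys where xs: "xs = y # ys" and "length ys = k" by (auto simp: length_Suc_conv)
  then show "(tl xs \<in> D (hd xs)) = sat (\<lambda>i. if i < Suc k then xs ! i else 0) f"
    unfolding xs list.sel by (intro assms)
qed

lemma iter_circuit_uniform: "AC0_uniform 5 (\<lambda>n. ccircuit_desc (iter_circuit n))"
proof -
  let ?is = "\<lambda>x c. Eq (Var x) (Num c)"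
  let ?sq = "\<lambda>s. Times s s"
  let ?f = "Disj (Conj (?is 1 0) (Conj (?is 2 0) (Conj (?is 3 0) (Conj (?is 4 0) (?is 5 1)))))
    (Disj (Conj (?is 1 1) (Conj (?is 3 0)
        (Disj (Conj (Less (Var 2) (Var 0)) (Conj (?is 4 1) (Eq (Var 5) (Var 2))))
          (Conj (Disj (Eq (Var 2) (Var 0)) (Eq (Var 2) (Plus (Var 0) (Num 1))))
            (Conj (?is 4 0) (?is 5 0))))))
      (Conj (?is 1 2) (Conj (Neg (Less (Var 0) (?sq (?sq (?sq (Plus (Var 2) (Num 1)))))))
        (Disj (Conj (?is 3 2) (Conj (?is 4 0) (?is 5 0)))
          (Conj (Disj (?is 3 3) (?is 3 4)) (Conj (Eq (Var 4) (Var 5)) (Less (Var 4) (Var 0))))))))"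
  have pow: "x * x * (x * x) * (x * x * (x * x)) = x ^ 8" for x :: nat
    by (simp add: eval_nat_numeral algebra_simps)
  show ?thesis
  proof (rule AC0_uniform_I [where f = ?f])
    fix n :: nat and xs :: "nat list" assume "length xs = 5"
    then obtain a b c d e where xs: "xs = [a, b, c, d, e]"
      by (auto simp: length_Suc_conv eval_nat_numeral)
    show "xs \<in> ccircuit_desc (iter_circuit n) \<longleftrightarrow>
        sat (\<lambda>i. if i < Suc 5 then (n # xs) ! i else 0) ?f"
      unfolding xs iter_desc_iff by (simp add: pow not_less nth_Cons' del: mult_Suc mult_Suc_right)
  qed
qed

lemma iter_circuit_family: "uniform_comparator_family iter_circuit"
  unfolding uniform_comparator_family_def comparator_family_def
proof (intro conjI allI iter_circuit_uniform)
  fix n show "wf_ccircuit n (iter_circuit n)"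
    by (auto simp: wf_ccircuit_def iter_circuit_def)
next
  have "(\<lambda>n. real (csize (iter_circuit n))) \<in> O(\<lambda>n. real n ^ 1)"
  proof (rule bigoI [where c = 4])
    show "\<forall>\<^sub>F n in sequentially. norm (real (csize (iter_circuit n))) \<le> 4 * norm (real n ^ 1)"
      using eventually_ge_at_top [of 1]
    proof eventually_elim
      case (elim n)
      then show ?case
        using iter_count_le [of n] by (simp add: csize_def iter_circuit_def)
    qed
  qed
  then show "\<exists>c. (\<lambda>n. real (csize (iter_circuit n))) \<in> O(\<lambda>n. real n ^ c)" by blast
qed

section \<open>Boolean circuits for iteration with duplication\<close>

definition dup_count :: "nat \<Rightarrow> nat" where
  "dup_count n = (floor_log n)\<^sup>2"

text \<open>\<open>floor_log n\<close> is the position of the leading bit of \<open>n\<close>. As it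
  is the largest position of a set bit, quantifying over all set bits expresses the bound without a
  logarithm.\<close>

lemma less_dup_count_iff: "k < dup_count n \<longleftrightarrow> (\<exists>l < n. bit n l \<and> k < l * l)"
proof
  assume k: "k < dup_count n"
  then have n: "0 < n" by (auto simp: dup_count_def intro!: gr0I)
  have le: "2 ^ floor_log n \<le> n" using n by (rule floor_log_exp2_le)
  have "n < 2 * 2 ^ floor_log n" by (rule floor_log_exp2_gt)
  then have "n div 2 ^ floor_log n = 1"
    using le by (metis One_nat_def Suc_1 div_nat_eqI mult.commute mult.right_neutral mult_Suc_right
      power_Suc)
  then have "bit n (floor_log n)" by (simp add: bit_iff_odd)
  moreover have "floor_log n < n" using le by (meson less_exp less_le_trans)
  ultimately show "\<exists>l < n. bit n l \<and> k < l * l"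
    using k by (auto simp: dup_count_def power2_eq_square)
next
  assume "\<exists>l < n. bit n l \<and> k < l * l"
  then obtain l where l: "bit n l" "k < l * l" by blast
  have "2 ^ l \<le> n"
  proof (rule ccontr)
    assume "\<not> 2 ^ l \<le> n"
    then show False using l(1) by (simp add: bit_iff_odd)
  qed
  then have "l \<le> floor_log n" using floor_log_le_iff [of "2 ^ l" n] by simp
  then show "k < dup_count n"
    using l(2) by (auto simp: dup_count_def power2_eq_square intro: less_le_trans mult_mono)
qed

definition dup_gate :: "nat \<Rightarrow> nat \<Rightarrow> bgate" where
  "dup_gate n k =
     BOracle (map (\<lambda>p. if k = 0 then SInput p else SGate (k - 1) (p div 5)) [0..<n])"

text \<open>The output is bit \<open>1\<close> of the last gate. There are gates only for
  \<open>n \<ge> 2\<close>, where this bit exists too; otherwise the output is constant.\<close>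

definition dup_circuit :: "nat \<Rightarrow> bcircuit" where
  "dup_circuit n = \<lparr>bgates = map (dup_gate n) [0..<dup_count n],
     bout = if dup_count n = 0 then SConst False else SGate (dup_count n - 1) 1\<rparr>"

lemma length_dup_gates [simp]: "length (bgates (dup_circuit n)) = dup_count n"
  by (simp add: dup_circuit_def)

lemma nth_dup_gates: "k < dup_count n \<Longrightarrow> bgates (dup_circuit n) ! k = dup_gate n k"
  by (simp add: dup_circuit_def)

lemma dup_count_pos: "2 \<le> n \<Longrightarrow> 0 < dup_count n"
  using floor_log_le_iff [of 2 n] floor_log_power [of 1] by (simp add: dup_count_def)

lemma dup_count_0 [simp]: "dup_count 0 = 0" "dup_count (Suc 0) = 0"
  by (simp_all add: dup_count_def)

lemma dup_countD: "k < dup_count n \<Longrightarrow> 2 \<le> n"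
  by (cases n; cases "n - 1") auto

lemma wf_dup_circuit: "wf_bcircuit n (dup_circuit n)"
proof -
  have "p div 5 < n" if "p < n" for p :: nat
    using that by (meson div_le_dividend le_less_trans)
  then show ?thesis
    unfolding wf_bcircuit_def
    by (auto simp: nth_dup_gates dup_gate_def outputs_def dest: dup_countD)
      (auto simp: dup_circuit_def dup_gate_def outputs_def dest: dup_countD)
qed

fun dup_query :: "oracle_fun \<Rightarrow> bool list \<Rightarrow> nat \<Rightarrow> bool list" where
  "dup_query \<alpha> X 0 = X"
| "dup_query \<alpha> X (Suc k) = map (\<lambda>p. \<alpha> (dup_query \<alpha> X k) ! (p div 5)) [0..<length X]"

lemma bvals_dup_circuit:
  assumes "k < dup_count (length X)"
  shows "bvals \<alpha> X (bgates (dup_circuit (length X))) ! k = \<alpha> (dup_query \<alpha> X k)"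
  using assms
proof (induction k)
  case 0
  have "map (\<lambda>p. X ! p) [0..<length X] = X" by (rule map_nth)
  then show ?case
    using 0 nth_bvals [of 0 "bgates (dup_circuit (length X))" \<alpha> X]
    by (simp add: nth_dup_gates dup_gate_def comp_def)
next
  case (Suc k)
  then show ?case
    using nth_bvals [of "Suc k" "bgates (dup_circuit (length X))" \<alpha> X]
    by (simp add: nth_dup_gates dup_gate_def comp_def take_bvals)
qed

lemma beval_dup_circuit:
  assumes "2 \<le> length X"
  shows "beval \<alpha> X (dup_circuit (length X)) =
    \<alpha> (dup_query \<alpha> X (dup_count (length X) - 1)) ! 1"
  using dup_count_pos [OF assms] bvals_dup_circuit [of "dup_count (length X) - 1" X \<alpha>]
  by (simp add: beval_bvals) (simp add: dup_circuit_def)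

text \<open>The gates form a chain, each reading the preceding one only, so a path to gate
  \<open>k\<close> has at most \<open>k + 1\<close> gates.\<close>

lemma dup_gate_depths:
  assumes "k < dup_count n"
  shows "gate_depths w (bgates (dup_circuit n)) ! k \<le> Suc k"
  using assms
proof (induction k)
  case 0
  have "source_depth ds s = 0" if "s \<in> set (sources (dup_gate n 0))" for ds s
    using that by (auto simp: dup_gate_def)
  then have "Max (insert 0 (source_depth (gate_depths w (take 0 (bgates (dup_circuit n)))) `
      set (sources (dup_gate n 0)))) \<le> 0"
    by (intro Max.boundedI) auto
  then show ?case
    using 0 by (subst nth_gate_depths) (auto simp: nth_dup_gates)
next
  case (Suc k)
  then have "source_depth (gate_depths w (take (Suc k) (bgates (dup_circuit n)))) s \<le> Suc k"
    if "s \<in> set (sources (dup_gate n (Suc k)))" for s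
    using that by (auto simp: dup_gate_def take_gate_depths)
  then have "Max (insert 0 (source_depth (gate_depths w (take (Suc k) (bgates (dup_circuit n)))) `
      set (sources (dup_gate n (Suc k))))) \<le> Suc k"
    by auto
  then show ?case
    using Suc.prems by (subst nth_gate_depths) (auto simp: nth_dup_gates)
qed

lemma dup_max_path: "max_path w (bgates (dup_circuit n)) \<le> dup_count n"
  unfolding max_path_def
proof (rule Max.boundedI)
  fix d assume "d \<in> insert 0 (set (gate_depths w (bgates (dup_circuit n))))"
  then consider "d = 0"
    | k where "k < dup_count n" "d = gate_depths w (bgates (dup_circuit n)) ! k"
    by (auto simp: in_set_conv_nth)
  then show "d \<le> dup_count n"
    by cases (auto intro: order_trans [OF dup_gate_depths])
qed auto

lemma dup_count_le_log: "0 < n \<Longrightarrow> real (dup_count n) \<le> log 2 (real n) ^ 2"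
  unfolding dup_count_def
  by (simp add: floor_log_altdef)

text \<open>A chain of at most log^2 n oracle gates meets both the nesting bound log^2 n and the
  depth bound log^3 n.\<close>

lemma dup_circuit_NC: "NC_family 3 dup_circuit"
  unfolding NC_family_def
proof (intro conjI allI wf_dup_circuit)
  have le: "\<forall>\<^sub>F n in sequentially. real (dup_count n) \<le> log 2 (real n) ^ 2"
    using eventually_gt_at_top [of 0] by eventually_elim (rule dup_count_le_log)
  have log1: "\<forall>\<^sub>F n in sequentially. 1 \<le> log 2 (real n)"
    using eventually_ge_at_top [of 2] by eventually_elim (simp add: le_log_iff)
  have "(\<lambda>n. real (bsize (dup_circuit n))) \<in> O(\<lambda>n. real n ^ 2)"
  proof (rule bigoI [where c = 1])
    show "\<forall>\<^sub>F n in sequentially. norm (real (bsize (dup_circuit n))) \<le> 1 * norm (real n ^ 2)"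
      using eventually_gt_at_top [of 0]
    proof eventually_elim
      case (elim n)
      have "floor_log n < 2 ^ floor_log n" by (rule less_exp)
      also have "\<dots> \<le> n" using elim by (rule floor_log_exp2_le)
      finally have "dup_count n \<le> n ^ 2" unfolding dup_count_def by (intro power_mono) auto
      then show ?case by (simp add: bsize_def flip: of_nat_power)
    qed
  qed
  then show "\<exists>c. (\<lambda>n. real (bsize (dup_circuit n))) \<in> O(\<lambda>n. real n ^ c)" by blast
  show "(\<lambda>n. real (bdepth (dup_circuit n))) \<in> O(\<lambda>n. log 2 (real n) ^ 3)"
  proof (rule bigoI [where c = 1])
    show "\<forall>\<^sub>F n in sequentially. norm (real (bdepth (dup_circuit n))) \<le> 1 * norm (log 2 (real n) ^ 3)"
      using le log1
    proof eventually_elim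
      case (elim n)
      have "real (bdepth (dup_circuit n)) \<le> real (dup_count n)"
        unfolding bdepth_def using dup_max_path by simp
      also have "\<dots> \<le> log 2 (real n) ^ 2" by (rule elim)
      also have "\<dots> \<le> log 2 (real n) ^ 3" using elim by (intro power_increasing) auto
      finally show ?case by simp
    qed
  qed
  show "(\<lambda>n. real (oracle_depth (dup_circuit n))) \<in> O(\<lambda>n. log 2 (real n) ^ (3 - 1))"
  proof (rule bigoI [where c = 1])
    show "\<forall>\<^sub>F n in sequentially.
        norm (real (oracle_depth (dup_circuit n))) \<le> 1 * norm (log 2 (real n) ^ (3 - 1))"
      using le
    proof eventually_elim
      case (elim n)
      have "real (oracle_depth (dup_circuit n)) \<le> real (dup_count n)"
        unfolding oracle_depth_def using dup_max_path by simp
      also have "\<dots> \<le> log 2 (real n) ^ 2" by (rule elim)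
      finally show ?case by simp
    qed
  qed
qed

text \<open>The predecessor and the quotient by five are rewritten as \<open>b = e + 1\<close> and
  two linear inequalities, which the formula language can state.\<close>

lemma dup_desc_iff:
  "[a, b, c, d, e, f] \<in> bcircuit_desc (dup_circuit n) \<longleftrightarrow>
     a = 0 \<and> b = 0 \<and> c = 0 \<and> (d = 0 \<and> e = 0 \<and> f = 0 \<and> \<not> 0 < dup_count n \<or>
       d = 2 \<and> f = 1 \<and> e < dup_count n \<and> \<not> e + 1 < dup_count n) \<or>
     b < dup_count n \<and> (a = 1 \<and> c = 3 \<and> d = 0 \<and> e = 0 \<and> f = 0 \<or>
       a = 2 \<and> c < n \<and> (b = 0 \<and> d = 1 \<and> e = c \<and> f = 0 \<or>
         d = 2 \<and> b = e + 1 \<and> 5 * f < c + 1 \<and> c < 5 * f + 5))"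
proof -
  have out: "[a, b, c, d, e, f] = [0, 0, 0] @ source_code (bout (dup_circuit n)) \<longleftrightarrow>
      a = 0 \<and> b = 0 \<and> c = 0 \<and> (d = 0 \<and> e = 0 \<and> f = 0 \<and> \<not> 0 < dup_count n \<or>
       d = 2 \<and> f = 1 \<and> e < dup_count n \<and> \<not> e + 1 < dup_count n)"
    by (auto simp: dup_circuit_def)
  have kind: "[a, b, c, d, e, f] \<in> {[1, k, bgate_kind (bgates (dup_circuit n) ! k), 0, 0, 0] | k.
        k < length (bgates (dup_circuit n))} \<longleftrightarrow>
      b < dup_count n \<and> a = 1 \<and> c = 3 \<and> d = 0 \<and> e = 0 \<and> f = 0"
    by (auto simp: nth_dup_gates dup_gate_def)
  have "[a, b, c, d, e, f] \<in> {[2, k, p] @ source_code (sources (bgates (dup_circuit n) ! k) ! p) |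
        k p. k < length (bgates (dup_circuit n)) \<and>
          p < length (sources (bgates (dup_circuit n) ! k))} \<longleftrightarrow>
      b < dup_count n \<and> a = 2 \<and> c < n \<and> (b = 0 \<and> d = 1 \<and> e = c \<and> f = 0 \<or>
         b \<noteq> 0 \<and> d = 2 \<and> e = b - 1 \<and> f = c div 5)"
    by (cases "b = 0") (auto simp: nth_dup_gates dup_gate_def)
  moreover have "b \<noteq> 0 \<and> d = 2 \<and> e = b - 1 \<and> f = c div 5 \<longleftrightarrow>
      d = 2 \<and> b = e + 1 \<and> 5 * f < c + 1 \<and> c < 5 * f + 5"
    by auto
  ultimately have src: "[a, b, c, d, e, f] \<in>
      {[2, k, p] @ source_code (sources (bgates (dup_circuit n) ! k) ! p) |
        k p. k < length (bgates (dup_circuit n)) \<and>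
          p < length (sources (bgates (dup_circuit n) ! k))} \<longleftrightarrow>
      b < dup_count n \<and> a = 2 \<and> c < n \<and> (b = 0 \<and> d = 1 \<and> e = c \<and> f = 0 \<or>
         d = 2 \<and> b = e + 1 \<and> 5 * f < c + 1 \<and> c < 5 * f + 5)"
    by simp
  show ?thesis
    unfolding bcircuit_desc_def Un_iff kind src singleton_iff out by blast
qed

lemma dup_circuit_uniform: "AC0_uniform 6 (\<lambda>n. bcircuit_desc (dup_circuit n))"
proof -
  let ?is = "\<lambda>x c. Eq (Var x) (Num c)"
  \<comment> \<open>\<open>?lt s\<close> says \<open>s < dup_count n\<close> by means of
    \<open>less_dup_count_iff\<close>. The bound variable 9 lies beyond the seven variables in
    use.\<close>
  let ?lt = "\<lambda>s. ExLess 9 (Var 0) (Conj (Bit (Var 0) (Var 9)) (Less s (Times (Var 9) (Var 9))))"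
  let ?f = "Disj (Conj (?is 1 0) (Conj (?is 2 0) (Conj (?is 3 0)
      (Disj (Conj (?is 4 0) (Conj (?is 5 0) (Conj (?is 6 0) (Neg (?lt (Num 0))))))
        (Conj (?is 4 2) (Conj (?is 6 1) (Conj (?lt (Var 5)) (Neg (?lt (Plus (Var 5) (Num 1)))))))))))
    (Conj (?lt (Var 2)) (Disj
      (Conj (?is 1 1) (Conj (?is 3 3) (Conj (?is 4 0) (Conj (?is 5 0) (?is 6 0)))))
      (Conj (?is 1 2) (Conj (Less (Var 3) (Var 0)) (Disj
        (Conj (?is 2 0) (Conj (?is 4 1) (Conj (Eq (Var 5) (Var 3)) (?is 6 0))))
        (Conj (?is 4 2) (Conj (Eq (Var 2) (Plus (Var 5) (Num 1)))
          (Conj (Less (Times (Num 5) (Var 6)) (Plus (Var 3) (Num 1)))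
            (Less (Var 3) (Plus (Times (Num 5) (Var 6)) (Num 5)))))))))))"
  show ?thesis
  proof (rule AC0_uniform_I [where f = ?f])
    fix n :: nat and xs :: "nat list" assume "length xs = 6"
    then obtain a b c d e g where xs: "xs = [a, b, c, d, e, g]"
      by (auto simp: length_Suc_conv eval_nat_numeral)
    have "sat (\<lambda>i. if i < Suc 6 then (n # xs) ! i else 0) (?lt s) \<longleftrightarrow> k < dup_count n"
      if "\<And>v. tm_val ((\<lambda>i. if i < Suc 6 then (n # xs) ! i else 0)(9 := v)) s = k" for s k
      unfolding less_dup_count_iff using that by simp
    note lt = this
    have "sat (\<lambda>i. if i < Suc 6 then (n # xs) ! i else 0) (?lt (Num 0)) \<longleftrightarrow> 0 < dup_count n"
      "sat (\<lambda>i. if i < Suc 6 then (n # xs) ! i else 0) (?lt (Var 2)) \<longleftrightarrow> b < dup_count n"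
      "sat (\<lambda>i. if i < Suc 6 then (n # xs) ! i else 0) (?lt (Var 5)) \<longleftrightarrow> e < dup_count n"
      "sat (\<lambda>i. if i < Suc 6 then (n # xs) ! i else 0) (?lt (Plus (Var 5) (Num 1)))
        \<longleftrightarrow> e + 1 < dup_count n"
      by (rule lt; simp add: xs nth_Cons')+
    note lts = this
    show "xs \<in> bcircuit_desc (dup_circuit n) \<longleftrightarrow>
        sat (\<lambda>i. if i < Suc 6 then (n # xs) ! i else 0) ?f"
      unfolding sat.simps(4,5) sat_Disj lts unfolding xs dup_desc_iff by (simp add: nth_Cons')
  qed
qed

lemma dup_circuit_family: "uniform_NC_family 3 dup_circuit"
  unfolding uniform_NC_family_def using dup_circuit_NC dup_circuit_uniform by blast

section \<open>Lower bounds\<close>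

text \<open>
  \<open>orc f i\<close> knows the first \<open>i\<close> balls only, and \<open>Qs\<close> collects the queries of a circuit. Its
  argument \<open>f 0\<close> encodes the input string of the circuit.
\<close>

lemma chain_exists:
  fixes W :: "'c set" and encP encQ :: "nat \<Rightarrow> 'c \<Rightarrow> nat set"
    and zone :: "nat \<Rightarrow> 'c \<Rightarrow> nat set \<Rightarrow> bool" and Qs :: "'c \<Rightarrow> oracle_fun \<Rightarrow> bool list set"
    and n :: nat
  assumes finQ: "\<And>c \<alpha>. finite (Qs c \<alpha>)" and cardQ: "\<And>c \<alpha>. card (Qs c \<alpha>) \<le> G"
    and unique: "\<And>j c d A. j \<le> L \<Longrightarrow> c \<in> W \<Longrightarrow> d \<in> W \<Longrightarrow> finite A \<Longrightarrow>
      zone j c A \<Longrightarrow> zone j d A \<Longrightarrow> c = d"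
    and large: "L * (G + 1) < card W"
  defines "orc f i \<equiv> set_oracle n (bump {..<i} (\<lambda>i. encP i (f i)) (\<lambda>i. encQ i (f (Suc i))))"
  shows "\<exists>f. (\<forall>j\<le>L. f j \<in> W) \<and> inj_on f {..L} \<and>
    (\<forall>j\<le>L. \<forall>i<j. \<forall>X\<in>Qs (f 0) (orc f i). \<not> zone j (f j) (ones X))"
proof -
  \<comment> \<open>The codewords whose zone at stage \<open>j\<close> contains the query;
    disjointness of the zones leaves at most one.\<close>
  define killed where "killed j X = {c \<in> W. zone j c (ones X)}" for j X
  define Bad where "Bad j f = f ` {..<j} \<union> (\<Union>i<j. \<Union>X\<in>Qs (f 0) (orc f i). killed j X)" for j f
  have finW: "finite W" using large by (metis card.infinite not_less_zero)
  have kill1: "card (killed j X) \<le> 1" if "j \<le> L" for j X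
  proof -
    have "finite (ones X)" using ones_subset finite_subset by blast
    then have "c = d" if "c \<in> killed j X" "d \<in> killed j X" for c d
      using unique [OF \<open>j \<le> L\<close>, of c d "ones X"] that by (auto simp: killed_def)
    moreover have "finite (killed j X)" using finW by (simp add: killed_def)
    ultimately show ?thesis by (metis One_nat_def card_le_Suc0_iff_eq)
  qed
  have cardBad: "card (Bad j f) < card W" if j: "j \<le> L" for j f
  proof -
    have "card (\<Union>X\<in>Qs c \<alpha>. killed j X) \<le> G" for c \<alpha>
    proof -
      have "card (\<Union>X\<in>Qs c \<alpha>. killed j X) \<le> (\<Sum>X\<in>Qs c \<alpha>. card (killed j X))"
        by (rule card_UN_le [OF finQ])
      also have "\<dots> \<le> (\<Sum>X\<in>Qs c \<alpha>. 1)" by (rule sum_mono) (rule kill1 [OF j])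
      finally show ?thesis using cardQ [of c \<alpha>] by simp
    qed
    then have "(\<Sum>i<j. card (\<Union>X\<in>Qs (f 0) (orc f i). killed j X)) \<le> (\<Sum>i<j. G)"
      by (intro sum_mono)
    moreover have "card (\<Union>i<j. \<Union>X\<in>Qs (f 0) (orc f i). killed j X)
        \<le> (\<Sum>i<j. card (\<Union>X\<in>Qs (f 0) (orc f i). killed j X))"
      by (rule card_UN_le) simp
    moreover have "card (f ` {..<j}) \<le> j" using card_image_le [of "{..<j}" f] by simp
    moreover have "card (Bad j f)
        \<le> card (f ` {..<j}) + card (\<Union>i<j. \<Union>X\<in>Qs (f 0) (orc f i). killed j X)"
      unfolding Bad_def by (rule card_Un_le)
    \<comment> \<open>There are \<open>j\<close> earlier codewords, and at most one killed codeword
      for each of at most \<open>G\<close> queries to each of \<open>j\<close> oracles.\<close>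
    ultimately have "card (Bad j f) \<le> j * (G + 1)" by simp
    also have "\<dots> \<le> L * (G + 1)" using j by (rule mult_le_mono1)
    finally show ?thesis using large by simp
  qed
  have "\<exists>f. \<forall>j\<le>L. f j \<in> W \<and> f j \<notin> Bad j f"
  proof (rule greedy_choice)
    fix j f assume "j \<le> L"
    show "\<exists>c\<in>W. c \<notin> Bad j f"
    proof (rule ccontr)
      assume "\<not> ?thesis"
      then have "W \<subseteq> Bad j f" by blast
      moreover have "finite (Bad j f)"
        using finQ finW by (auto simp: Bad_def killed_def)
      ultimately show False using cardBad [OF \<open>j \<le> L\<close>, of f] card_mono by (metis not_le)
    qed
  next
    fix j and f g :: "nat \<Rightarrow> 'c" assume eq: "\<And>i. i < j \<Longrightarrow> f i = g i"
    \<comment> \<open>The centres and targets in \<open>orc f i\<close> involve values of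
      \<open>f\<close> up to \<open>f i\<close> at most, and \<open>i < j\<close>.\<close>
    have "orc f i = orc g i" if "i < j" for i
    proof -
      have "bump {..<i} (\<lambda>i. encP i (f i)) (\<lambda>i. encQ i (f (Suc i))) A
          = bump {..<i} (\<lambda>i. encP i (g i)) (\<lambda>i. encQ i (g (Suc i))) A" for A
        using eq that by (intro bump_cong) auto
      then show ?thesis unfolding orc_def by presburger
    qed
    moreover have "f 0 = g 0" if "i < j" for i using eq that by simp
    moreover have "f ` {..<j} = g ` {..<j}" using eq by (intro image_cong) auto
    ultimately show "Bad j f = Bad j g" unfolding Bad_def by simp
  qed
  then obtain f where f: "\<And>j. j \<le> L \<Longrightarrow> f j \<in> W" "\<And>j. j \<le> L \<Longrightarrow> f j \<notin> Bad j f" by blast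
  have "f i \<noteq> f j" if "i < j" "j \<le> L" for i j
  proof -
    have "f j \<notin> f ` {..<j}" using f(2) [OF that(2)] by (simp add: Bad_def)
    then show ?thesis using that(1) by (metis imageI lessThan_iff)
  qed
  then have "inj_on f {..L}"
    by (intro linorder_inj_onI') auto
  moreover have "\<not> zone j (f j) (ones X)" if "j \<le> L" "i < j" "X \<in> Qs (f 0) (orc f i)" for i j X
    using f(1,2) [OF that(1)] that by (auto simp: Bad_def killed_def)
  ultimately show ?thesis using f(1) by blast
qed

section \<open>Circuits querying the bump oracles\<close>

context bumps
begin

abbreviation bump_oracle :: "nat set \<Rightarrow> oracle_fun" where
  "bump_oracle I \<equiv> set_oracle n (bump I P Q)"

lemma bump_center_unhit:
  assumes "I \<subseteq> {..<L}" "i < L" "i \<notin> I"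
  shows "bump I P Q (P i) = parity_set (P i)"
proof (rule bump_unhit)
  fix j assume "j \<in> I"
  then show "\<not> hit j (P i)"
    using hit_unique [of i j "P i"] assms finite_P by fastforce
qed

text \<open>Induction on \<open>j\<close>. A query of depth at most \<open>j\<close> misses ball
  \<open>j\<close>, so adding that ball changes no answer up to depth \<open>j\<close> and no query
  of depth \<open>j + 1\<close>; freshness then keeps this query out of ball \<open>j + 1\<close>.
  At depth \<open>0\<close> there are no oracle gates.\<close>

lemma bquery_unhit:
  assumes wf: "wf_bgates n' gs" and iL: "j < L"
    and fresh: "\<And>i k. Suc i < L \<Longrightarrow> k < length gs \<Longrightarrow> is_oracle (gs ! k) \<Longrightarrow>
      \<not> hit (Suc i) (ones (bquery (bump_oracle {..<i}) X gs k))"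
    and "k < length gs" "is_oracle (gs ! k)" "gate_depths is_oracle gs ! k \<le> j"
  shows "\<not> hit j (ones (bquery (bump_oracle {..<j}) X gs k))"
  using assms(2,4-)
proof (induction j arbitrary: k)
  case 0
  then show ?case using nth_gate_depths [of k gs is_oracle] by simp
next
  case (Suc j)
  have "bump_oracle {..<j} (bquery (bump_oracle {..<j}) X gs k')
      = bump_oracle {..<Suc j} (bquery (bump_oracle {..<j}) X gs k')"
    if "k' < length gs" "is_oracle (gs ! k')" "gate_depths is_oracle gs ! k' \<le> j" for k'
  proof (intro set_oracle_cong bump_eq_if_unhit)
    fix i assume "i \<in> {..<Suc j} - {..<j}"
    then have "i = j" by auto
    then show "card (Q i) \<le> sdist (ones (bquery (bump_oracle {..<j}) X gs k')) (P i)"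
      using Suc.IH [of k'] that Suc.prems(1) by simp
  qed auto
  then have "bquery (bump_oracle {..<Suc j}) X gs k = bquery (bump_oracle {..<j}) X gs k"
    using Suc.prems by (intro bquery_agree(2) [OF wf, where d = j]) auto
  then show ?case using fresh [of j k] Suc.prems by simp
qed

text \<open>All queries have depth at most \<open>L - 1\<close>, so they miss the last ball and its
  removal goes unnoticed.\<close>

lemma low_depth_blind:
  assumes wf: "wf_bcircuit n' C" and "0 < L" and depth: "oracle_depth C < L"
    and fresh: "\<And>i k. Suc i < L \<Longrightarrow> k < bsize C \<Longrightarrow> is_oracle (bgates C ! k) \<Longrightarrow>
      \<not> hit (Suc i) (ones (bquery (bump_oracle {..<i}) X (bgates C) k))"
  shows "beval (bump_oracle {..<L - 1}) X C = beval (bump_oracle {..<L}) X C"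
proof -
  let ?gs = "bgates C" and ?\<alpha> = "bump_oracle {..<L - 1}" and ?\<beta> = "bump_oracle {..<L}"
  have wf': "wf_bgates n' ?gs" using wf by (auto simp: wf_bcircuit_def wf_bgates_def)
  have d: "gate_depths is_oracle ?gs ! k \<le> L - 1" if "k < length ?gs" for k
    using gate_depths_le_max_path [OF that, of is_oracle] depth by (simp add: oracle_depth_def)
  have "?\<alpha> (bquery ?\<alpha> X ?gs k) = ?\<beta> (bquery ?\<alpha> X ?gs k)"
    if k: "k < length ?gs" "is_oracle (?gs ! k)" for k
  proof (intro set_oracle_cong bump_eq_if_unhit)
    fix i assume "i \<in> {..<L} - {..<L - 1}"
    then have "i = L - 1" by auto
    then show "card (Q i) \<le> sdist (ones (bquery ?\<alpha> X ?gs k)) (P i)"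
      using bquery_unhit [OF wf', of "L - 1" X k] fresh k d \<open>0 < L\<close> by (auto simp: bsize_def)
  qed auto
  then have vals: "bvals ?\<beta> X ?gs ! k = bvals ?\<alpha> X ?gs ! k" if "k < length ?gs" for k
    using bquery_agree(1) [OF wf', of "L - 1" ?\<alpha> X ?\<beta> k] that d by blast
  have "wf_source n' ?gs (bout C)" using wf by (simp add: wf_bcircuit_def)
  then show ?thesis using vals by (cases "bout C") (auto simp: beval_bvals)
qed

text \<open>\<open>A\<close> and \<open>B\<close> are the arguments of the same gate in the runs with and without ball \<open>i\<close>.\<close>

lemma token_balance:
  assumes w: "\<And>j. j < L \<Longrightarrow> card (Q j) = w" and n: "0 < n"
    and i: "Suc i < L" and AB: "A \<subseteq> {..<n}" "B \<subseteq> {..<n}" and far': "4 * w \<le> sdist B (P (Suc i))"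
  shows "sdist (bump {..<L} P Q A) (bump ({..<L} - {i}) P Q B) + of_bool (hit (Suc i) A) * (2 * w)
    \<le> sdist A B + of_bool (hit i A) * w"
proof -
  let ?F = "bump {..<L} P Q" and ?G = "bump ({..<L} - {i}) P Q"
  have fin: "finite A" "finite B" using AB by (auto intro: finite_subset)
  have wpos: "0 < w" using card_Q_pos [of i] w [of i] i by simp
  have lip: "sdist (?G A) (?G B) \<le> sdist A B"
    using AB by (intro bump_lipschitz) auto
  consider "hit i A" | "hit (Suc i) A" | "\<not> hit i A" "\<not> hit (Suc i) A" by blast
  then show ?thesis
  proof cases
    case 1
    have "\<not> hit (Suc i) A" using hit_unique [of i "Suc i" A] 1 i fin by auto
    \<comment> \<open>Removing ball \<open>i\<close> changes the answer to \<open>A\<close> by at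
      most \<open>w\<close>, which the last term on the right pays for.\<close>
    moreover have "sdist (?F A) (?G A) \<le> w"
    proof -
      have "?G A \<subseteq> ?F A" by (auto simp: bump_def)
      then have "sdist (?F A) (?G A) \<le> card (?F A)"
        unfolding sdist_def by (intro card_mono) auto
      also have "\<dots> \<le> w" using fin w wpos by (intro card_bump_le) auto
      finally show ?thesis .
    qed
    moreover have "sdist (?F A) (?G B) \<le> sdist (?F A) (?G A) + sdist (?G A) (?G B)"
      by (intro sdist_triangle) auto
    ultimately show ?thesis using lip 1 by simp
  next
    case 2
    have "\<not> hit i A" using hit_unique [of "Suc i" i A] 2 i fin by auto
    moreover have "card (?F A) = w - sdist A (P (Suc i))"
      using bump_hit [of "{..<L}" "Suc i" A] 2 i fin w card_least_elems [OF finite_Q] by simp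
    moreover have "card (?G B) \<le> w" using fin w wpos by (intro card_bump_le) auto
    moreover have "sdist (?F A) (?G B) \<le> card (?F A) + card (?G B)"
      by (intro sdist_le_add) auto
    moreover have "sdist B (P (Suc i)) \<le> sdist B A + sdist A (P (Suc i))"
      using fin i finite_P by (intro sdist_triangle) auto
    \<comment> \<open>With \<open>d\<close> the distance of \<open>A\<close> to the centre, the
      answers have weights \<open>w - d\<close> and at most \<open>w\<close>, while \<open>A\<close>
      and \<open>B\<close> differ in at least \<open>4 * w - d\<close> places: at least
      \<open>2 * w\<close> tokens disappear.\<close>
    ultimately show ?thesis using far' 2 w [OF i] by (simp add: sdist_commute)
  next
    case 3
    have "?F A = ?G A" using 3 by (intro bump_eq_if_unhit) auto
    then show ?thesis using lip 3 by simp
  qed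
qed

text \<open>\<open>K i\<close> counts the queries in ball \<open>i\<close>. Comparing the run with
  all balls to the run without ball \<open>i\<close> gives \<open>2 * K (Suc i) \<le> K i\<close>.
  The last ball is queried because its removal changes the final state, so \<open>K 0\<close> is
  exponential in \<open>L\<close>.\<close>

lemma many_queries:
  assumes wf: "\<forall>g\<in>set gs. wf_cgate n (length v) g" and w: "\<And>j. j < L \<Longrightarrow> card (Q j) = w"
    and n: "0 < n" and "0 < L"
    and fresh: "\<And>i j A. i < j \<Longrightarrow> j < L \<Longrightarrow> A \<in> set (cqueries (bump_oracle {..<i}) v gs) \<Longrightarrow>
      4 * w \<le> sdist (ones A) (P j)"
    and differ: "fold (cgate_step (bump_oracle {..<L - 1})) gs v \<noteq> fold (cgate_step (bump_oracle {..<L})) gs v"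
  shows "2 ^ (L - 1) \<le> length gs"
proof -
  define K where "K i = length (filter (\<lambda>A. hit i (ones A)) (cqueries (bump_oracle {..<L}) v gs))" for i
  have wpos: "0 < w" using card_Q_pos [of 0] w [of 0] \<open>0 < L\<close> by simp
  have pos: "0 < K (L - 1)"
  proof (rule ccontr)
    assume "\<not> 0 < K (L - 1)"
    then have no: "\<not> hit (L - 1) (ones A)" if "A \<in> set (cqueries (bump_oracle {..<L}) v gs)" for A
      using that by (simp add: K_def filter_empty_conv)
    have "bump_oracle {..<L} A = bump_oracle {..<L - 1} A" if "A \<in> set (cqueries (bump_oracle {..<L}) v gs)" for A
    proof (intro set_oracle_cong bump_eq_if_unhit)
      fix i assume "i \<in> {..<L} - {..<L - 1}"
      then have "i = L - 1" by auto
      then show "card (Q i) \<le> sdist (ones A) (P i)" using no [OF that] by simp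
    qed auto
    then show False using cqueries_agree(2) differ by blast
  qed
  have step: "2 * K (Suc i) \<le> K i" if i: "Suc i < L" for i
  proof -
    let ?\<alpha> = "bump_oracle {..<L}" and ?\<beta> = "bump_oracle ({..<L} - {i})"
    \<comment> \<open>The run with the first \<open>i\<close> balls never gets near a later one, so
      it is also the run without ball \<open>i\<close> alone, and \<open>fresh\<close> applies to
      the latter.\<close>
    have "bump_oracle {..<i} A = ?\<beta> A" if A: "A \<in> set (cqueries (bump_oracle {..<i}) v gs)" for A
    proof (intro set_oracle_cong bump_eq_if_unhit)
      fix j assume "j \<in> {..<L} - {i} - {..<i}"
      then have j: "i < j" "j < L" by auto
      then show "card (Q j) \<le> sdist (ones A) (P j)"
        using fresh [OF j A] w by simp
    qed (use i in auto)
    then have eq: "cqueries ?\<beta> v gs = cqueries (bump_oracle {..<i}) v gs"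
      by (rule cqueries_agree(1))
    have "K (Suc i) * (2 * w) \<le> hamming v v + K i * w"
      unfolding K_def
    proof (rule token_count [OF wf refl])
      show "length_preserving ?\<alpha>" "length_preserving ?\<beta>" by (simp_all add: length_preserving_def)
      fix A B :: "bool list"
      assume len: "length A = n" "length B = n" and B: "B \<in> set (cqueries ?\<beta> v gs)"
      have sub: "ones A \<subseteq> {..<n}" "ones B \<subseteq> {..<n}"
        using ones_subset [of A] ones_subset [of B] len by auto
      have "4 * w \<le> sdist (ones B) (P (Suc i))"
        using fresh [of i "Suc i" B] B i eq by simp
      then have bal: "sdist (bump {..<L} P Q (ones A)) (bump ({..<L} - {i}) P Q (ones B))
            + of_bool (hit (Suc i) (ones A)) * (2 * w)
          \<le> sdist (ones A) (ones B) + of_bool (hit i (ones A)) * w"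
        by (intro token_balance w n i sub)
      have "hamming (?\<alpha> A) (?\<beta> B)
          = sdist (bump {..<L} P Q (ones A)) (bump ({..<L} - {i}) P Q (ones B))"
        using len n by (simp add: hamming_eq_sdist set_oracle_def ones_bits bump_sub)
      then show "hamming (?\<alpha> A) (?\<beta> B) + of_bool (hit (Suc i) (ones A)) * (2 * w)
          \<le> hamming A B + of_bool (hit i (ones A)) * w"
        using bal len by (simp add: hamming_eq_sdist)
    qed
    \<comment> \<open>Both runs start in the same state, so there are no tokens at the
      beginning.\<close>
    moreover have "hamming v v = 0" by (simp add: hamming_def)
    ultimately show ?thesis using wpos by (simp add: mult.assoc mult.left_commute)
  qed
  have "2 ^ i \<le> K (L - 1 - i)" if "i \<le> L - 1" for i
    using that
  proof (induction i)
    case 0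
    then show ?case using pos by simp
  next
    case (Suc i)
    have "Suc (L - 1 - Suc i) = L - 1 - i" using Suc.prems by simp
    then have "2 * K (L - 1 - i) \<le> K (L - 1 - Suc i)"
      using step [of "L - 1 - Suc i"] Suc.prems \<open>0 < L\<close> by simp
    then show ?case using Suc by simp
  qed
  from this [of "L - 1"] have "2 ^ (L - 1) \<le> K 0" by simp
  also have "\<dots> \<le> length (cqueries (bump_oracle {..<L}) v gs)" by (simp add: K_def)
  also have "\<dots> \<le> length gs" by (rule length_cqueries)
  finally show ?thesis .
qed

end

section \<open>Both relations evaluated on the bump oracles\<close>

context bumps
begin

text \<open>At the last centre the full oracle returns \<open>Q (L - 1)\<close>, while without the
  last ball the answer is a \<open>parity_set\<close>, which can contain only
  \<open>0\<close>.\<close>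

lemma bump_center_bit:
  assumes n: "2 \<le> n" and "0 < L" and one: "1 \<in> Q (L - 1)"
  shows "bump_oracle {..<L} (bits n (P (L - 1))) ! 1"
    and "\<not> bump_oracle {..<L - 1} (bits n (P (L - 1))) ! 1"
proof -
  have P: "P (L - 1) \<subseteq> {..<n}" using P_sub [of "L - 1"] \<open>0 < L\<close> by simp
  show "bump_oracle {..<L} (bits n (P (L - 1))) ! 1"
    unfolding set_oracle_bits [OF P] using bump_center [of "{..<L}" "L - 1"] assms by simp
  have "bump {..<L - 1} P Q (P (L - 1)) = parity_set (P (L - 1))"
    using \<open>0 < L\<close> by (intro bump_center_unhit) auto
  then show "\<not> bump_oracle {..<L - 1} (bits n (P (L - 1))) ! 1"
    unfolding set_oracle_bits [OF P] using n by (simp add: parity_set_def)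
qed

text \<open>Reaching \<open>P k\<close> uses the balls below \<open>k\<close> only; so for
  \<open>k = L - 1\<close> the oracles with and without the last ball follow the same path to its
  centre.\<close>

lemma iterate_bump_oracle:
  assumes next_center: "\<And>i. Suc i < L \<Longrightarrow> P (Suc i) = Q i"
    and "k < L" "{..<k} \<subseteq> I" "I \<subseteq> {..<L}"
  shows "(bump_oracle I ^^ k) (bits n (P 0)) = bits n (P k)"
  using assms(2-)
proof (induction k)
  case (Suc k)
  have "bump I P Q (P k) = Q k" using Suc.prems by (intro bump_center) auto
  then have "bump_oracle I (bits n (P k)) = bits n (P (Suc k))"
    using Suc.prems P_sub [of k] next_center [of k] by (simp add: set_oracle_bits)
  moreover have "(bump_oracle I ^^ k) (bits n (P 0)) = bits n (P k)"
    using Suc.prems by (intro Suc.IH) auto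
  ultimately show ?case by simp
qed simp

lemma dup_query_bump_oracle:
  assumes next_center: "\<And>i. Suc i < L \<Longrightarrow> P (Suc i) = dup (Q i)"
    and "k < L" "{..<k} \<subseteq> I" "I \<subseteq> {..<L}"
  shows "dup_query (bump_oracle I) (bits n (P 0)) k = bits n (P k)"
  using assms(2-)
proof (induction k)
  case (Suc k)
  have "bump I P Q (P k) = Q k" using Suc.prems by (intro bump_center) auto
  then have "bump_oracle I (bits n (P k)) = bits n (Q k)"
    using Suc.prems P_sub [of k] by (simp add: set_oracle_bits)
  moreover have "dup_query (bump_oracle I) (bits n (P 0)) k = bits n (P k)"
    using Suc.prems by (intro Suc.IH) auto
  ultimately show ?case
    using Suc.prems Q_sub [of k] next_center [of k] by (simp add: bits_dup)
qed simp

end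

section \<open>Adversary oracles for a single circuit at length \<open>t ^ 8\<close>\<close>

lemma large_code_at_square:
  assumes "m \<le> t ^ 2" "0 < t" "N < t ^ (2 * m)"
  obtains W where "code (t ^ 2) (t ^ 4) m W" "N < card W"
proof -
  obtain W where "code (t ^ 2) (t ^ 2 * t ^ 2) m W" "(t ^ 2) ^ m \<le> card W"
    using large_code_exists [of "t ^ 2" m] assms by auto
  moreover have "t ^ 2 * t ^ 2 = t ^ 4" by (simp flip: power_add)
  ultimately show ?thesis using that [of W] assms(3) by (simp add: power_mult)
qed

lemma enc_sub_power:
  assumes "f \<in> {..<t ^ 2} \<rightarrow>\<^sub>E {..<t ^ 4}" "r \<le> t ^ 2"
  shows "enc (t ^ 4) f r \<subseteq> {..<t ^ 6 + 2}"
  using enc_sub [OF assms] by (simp flip: power_add)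

text \<open>Encoded words lie below \<open>t ^ 6 + 2\<close>, and five copies of these positions
  have to fit into strings of length \<open>t ^ 8\<close>.\<close>

lemma power_gap: "3 \<le> t \<Longrightarrow> 5 * (t ^ 6 + 2) \<le> (t::nat) ^ 8"
proof -
  assume t: "3 \<le> t"
  have "3 ^ 2 \<le> t ^ 2" using t by (rule power_mono) simp
  then have "9 * t ^ 6 \<le> t ^ 2 * t ^ 6" by (intro mult_right_mono) auto
  also have "\<dots> = t ^ 8" by (simp flip: power_add)
  finally have "9 * t ^ 6 \<le> t ^ 8" .
  moreover have "3 \<le> t ^ 6" using t self_le_power [of t 6] by linarith
  moreover have "9 * x \<le> y \<Longrightarrow> 3 \<le> x \<Longrightarrow> 5 * (x + 2) \<le> y" for x y :: nat by presburger
  ultimately show ?thesis by blast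
qed

text \<open>
  The radii decrease by \<open>2 (m + 1)\<close> per step, as balls of radius equal to the weight of the
  centers would intersect.
\<close>

lemma iteration_needs_depth:
  assumes t: "3 \<le> t" and margin: "2 * (m + 1) * (t + 1) \<le> t ^ 2"
    and wf: "wf_bcircuit (t ^ 8) C" and depth: "oracle_depth C < t"
    and size: "t * (bsize C + 1) < t ^ (2 * m)"
  shows "\<exists>X. \<exists>\<alpha>\<in>Strict_Lipschitz_Oracles. length X = t ^ 8 \<and> beval \<alpha> X C \<noteq> (\<alpha> ^^ t) X ! 1"
proof -
  define n where "n = t ^ 8"
  define q where "q = t ^ 2"
  define b where "b = t ^ 4"
  define r where "r i = q - 2 * (m + 1) * i" for i
  define E where "E i c = enc b c (r i)" for i c
  have n: "5 * (t ^ 6 + 2) \<le> n" unfolding n_def using t by (rule power_gap)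
  have rq: "r i \<le> q" for i by (simp add: r_def)
  \<comment> \<open>\<open>margin\<close> keeps the subtraction in \<open>r\<close> exact up to
    index \<open>t + 1\<close>, which the zone of the last word \<open>f t\<close> refers
    to.\<close>
  have rS: "r i = r (Suc i) + 2 * (m + 1)" if "i \<le> t" for i
  proof -
    have "2 * (m + 1) * Suc i \<le> 2 * (m + 1) * (t + 1)" using that by (intro mult_le_mono2) simp
    then have "2 * (m + 1) * Suc i \<le> q" using margin by (simp add: q_def)
    then show ?thesis unfolding r_def by simp
  qed
  have "m \<le> t ^ 2" using margin by (simp add: algebra_simps)
  then obtain W where W: "code q b m W" and card: "t * (bsize C + 1) < card W"
    using large_code_at_square [of m t "t * (bsize C + 1)"] size t unfolding q_def b_def by auto
  have WF: "c \<in> {..<q} \<rightarrow>\<^sub>E {..<b}" if "c \<in> W" for c using W that by (auto simp: code_def)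
  have card_E: "card (E i c) = r i + 2" if "c \<in> W" for i c
    unfolding E_def using card_enc WF [OF that] rq by blast
  have fin_E: "finite (E i c)" for i c by (simp add: E_def)
  have sub_E: "E i c \<subseteq> {..<n}" if "c \<in> W" for i c
    using enc_sub_power [of c t "r i"] WF [OF that] rq [of i] n
    unfolding E_def q_def b_def by fastforce
  have dist_E: "r i + r j + 4 \<le> sdist (E i c) (E j d) + 2 * (m + 1)"
    if "c \<in> W" "d \<in> W" "c \<noteq> d" for i j c d
    unfolding E_def using sdist_enc [OF W that] rq by blast
  define Qs where "Qs c \<alpha> = bquery \<alpha> (bits n (E 0 c)) (bgates C) ` {..<bsize C}" for c \<alpha>
  define orc where "orc f i = set_oracle n (bump {..<i} (\<lambda>i. E i (f i)) (\<lambda>i. E (Suc i) (f (Suc i))))"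
    for f i
  have "\<exists>f. (\<forall>j\<le>t. f j \<in> W) \<and> inj_on f {..t} \<and>
    (\<forall>j\<le>t. \<forall>i<j. \<forall>X\<in>Qs (f 0) (orc f i). \<not> sdist (ones X) (E j (f j)) < r (Suc j) + 2)"
    unfolding orc_def
  proof (rule chain_exists [where encP = E and encQ = "\<lambda>i. E (Suc i)" and G = "bsize C"
        and zone = "\<lambda>j c A. sdist A (E j c) < r (Suc j) + 2"])
    show "finite (Qs c \<alpha>)" "card (Qs c \<alpha>) \<le> bsize C" for c \<alpha>
      unfolding Qs_def using card_image_le [of "{..<bsize C}"] by auto
    show "c = d" if "j \<le> t" "c \<in> W" "d \<in> W" "finite A"
      "sdist A (E j c) < r (Suc j) + 2" "sdist A (E j d) < r (Suc j) + 2" for j c d A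
    proof (rule ccontr)
      assume "c \<noteq> d"
      have "sdist (E j c) (E j d) \<le> sdist (E j c) A + sdist A (E j d)"
        using that(4) fin_E by (intro sdist_triangle)
      \<comment> \<open>Two words of weight \<open>r j + 2\<close> are at distance at least
        \<open>2 * (r j + 2) - 2 * (m + 1)\<close>, which exceeds twice the radius
        \<open>r (Suc j) + 2\<close>.\<close>
      then show False
        using dist_E [OF that(2,3) \<open>c \<noteq> d\<close>, of j j] that rS [of j] by (simp add: sdist_commute)
    qed
  qed (rule card)
  then obtain f where f: "\<And>j. j \<le> t \<Longrightarrow> f j \<in> W" and inj: "inj_on f {..t}"
    and fresh: "\<And>i j X. j \<le> t \<Longrightarrow> i < j \<Longrightarrow> X \<in> Qs (f 0) (orc f i) \<Longrightarrow>
      \<not> sdist (ones X) (E j (f j)) < r (Suc j) + 2" by blast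
  define P where "P i = E i (f i)" for i
  define Q where "Q i = E (Suc i) (f (Suc i))" for i
  have card_P: "card (P i) = r i + 2" if "i < t" for i
    unfolding P_def using f [of i] that by (intro card_E) simp
  have card_Q: "card (Q i) = r (Suc i) + 2" if "i < t" for i
    unfolding Q_def using f [of "Suc i"] that by (intro card_E) simp
  interpret bumps n t P Q
  proof
    fix i assume i: "i < t"
    show "P i \<subseteq> {..<n}" "Q i \<subseteq> {..<n}"
      unfolding P_def Q_def using f [of i] f [of "Suc i"] i by (simp_all add: sub_E)
    show "0 \<in> Q i" by (simp add: Q_def E_def enc_def)
    \<comment> \<open>The weights of a centre and its target differ by the even number
      \<open>2 * (m + 1)\<close>.\<close>
    show "even (card (P i) + card (Q i))"
      using card_P [OF i] card_Q [OF i] rS [of i] i by simp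
    fix j assume j: "j < t" and "i \<noteq> j"
    then have "f i \<noteq> f j" using inj i by (auto dest: inj_onD)
    then have "r i + r j + 4 \<le> sdist (P i) (P j) + 2 * (m + 1)"
      unfolding P_def using f i j by (intro dist_E) auto
    then show "card (Q i) + card (Q j) \<le> sdist (P i) (P j)"
      using card_Q [OF i] card_Q [OF j] rS [of i] rS [of j] i j by simp
  qed
  let ?X = "bits n (P 0)"
  have orc: "bump_oracle {..<i} = orc f i" for i by (simp add: orc_def P_def [abs_def] Q_def [abs_def])
  have "beval (bump_oracle {..<t - 1}) ?X C = beval (bump_oracle {..<t}) ?X C"
  proof (rule low_depth_blind)
    show "wf_bcircuit n C" "0 < t" "oracle_depth C < t" using wf depth t by (simp_all add: n_def)
    fix i k assume i: "Suc i < t" and k: "k < bsize C"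
    have "bquery (orc f i) ?X (bgates C) k \<in> Qs (f 0) (orc f i)"
      using k by (auto simp: Qs_def P_def)
    then show "\<not> hit (Suc i) (ones (bquery (bump_oracle {..<i}) ?X (bgates C) k))"
      using fresh [of "Suc i" i] i card_Q [of "Suc i"] unfolding orc by (simp add: P_def)
  qed
  moreover have "(bump_oracle {..<t} ^^ t) ?X ! 1" "\<not> (bump_oracle {..<t - 1} ^^ t) ?X ! 1"
  proof -
    have "(bump_oracle I ^^ t) ?X = bump_oracle I (bits n (P (t - 1)))"
      if "{..<t - 1} \<subseteq> I" "I \<subseteq> {..<t}" for I
    proof -
      obtain s where s: "t = Suc s" using t by (cases t) auto
      have "(bump_oracle I ^^ s) ?X = bits n (P s)"
        using that s by (intro iterate_bump_oracle) (auto simp: P_def Q_def)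
      then show ?thesis by (simp add: s)
    qed
    moreover have "1 \<in> Q (t - 1)" by (simp add: Q_def E_def enc_def)
    ultimately show "(bump_oracle {..<t} ^^ t) ?X ! 1" "\<not> (bump_oracle {..<t - 1} ^^ t) ?X ! 1"
      using bump_center_bit n t by auto
  qed
  moreover have "bump_oracle {..<t} \<in> Strict_Lipschitz_Oracles"
    "bump_oracle {..<t - 1} \<in> Strict_Lipschitz_Oracles"
    using n by (auto intro!: bump_strict)
  \<comment> \<open>The circuit gives the same value for both oracles, whereas the iterates differ
    in bit \<open>1\<close>; so it is wrong for one of them.\<close>
  ultimately show ?thesis unfolding n_def [symmetric] by (metis length_bits)
qed

text \<open>All words keep the full weight \<open>w\<close>, as duplication makes room: centres have
  weight \<open>5 * w\<close> and distance at least \<open>8 * w\<close>, so zones of radius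
  \<open>4 * w\<close> are disjoint and the greedy choice keeps the queries of runs with fewer balls
  out of them. Noticing the last ball then takes \<open>2 ^ (L - 1)\<close> gates.\<close>

lemma duplication_needs_size:
  assumes t: "3 \<le> t" and margin: "5 * (m + 1) \<le> t ^ 2 + 2"
    and wf: "wf_ccircuit (t ^ 8) C"
    and size: "dup_count (t ^ 8) * (csize C + 1) < t ^ (2 * m)"
    and short: "csize C < 2 ^ (dup_count (t ^ 8) - 1)"
  shows "\<exists>X. \<exists>\<alpha>\<in>Strict_Lipschitz_Oracles. length X = t ^ 8 \<and>
    ceval \<alpha> X C \<noteq> beval \<alpha> X (dup_circuit (length X))"
proof -
  define n where "n = t ^ 8"
  define q where "q = t ^ 2"
  define b where "b = t ^ 4"
  define w where "w = q + 2"
  define L where "L = dup_count n"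
  define E where "E c = enc b c q" for c
  have n: "5 * (t ^ 6 + 2) \<le> n" unfolding n_def using t by (rule power_gap)
  have L: "0 < L" unfolding L_def using n by (intro dup_count_pos) simp
  have "m \<le> t ^ 2" using margin by simp
  then obtain W where W: "code q b m W" and card: "L * (csize C + 1) < card W"
    using large_code_at_square [of m t "L * (csize C + 1)"] size t
    unfolding q_def b_def L_def n_def by auto
  have WF: "c \<in> {..<q} \<rightarrow>\<^sub>E {..<b}" if "c \<in> W" for c using W that by (auto simp: code_def)
  have card_E: "card (E c) = w" if "c \<in> W" for c
    unfolding E_def w_def using card_enc WF [OF that] by blast
  have fin_E: "finite (dup (E c))" for c by (simp add: E_def finite_dup)
  have sub_E: "E c \<subseteq> {..<t ^ 6 + 2}" if "c \<in> W" for c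
    using enc_sub_power [of c t q] WF [OF that] unfolding E_def q_def b_def by simp
  \<comment> \<open>The fivefold distance is at least \<open>10 * w - 10 * (m + 1)\<close>, and
    \<open>margin\<close> bounds the loss by \<open>2 * w\<close>.\<close>
  have dist_E: "8 * w \<le> sdist (dup (E c)) (dup (E d))" if "c \<in> W" "d \<in> W" "c \<noteq> d" for c d
    using sdist_enc [OF W that, of q q] margin unfolding E_def w_def q_def sdist_dup by simp
  define v where "v c = map (annotation_val (bits n (dup (E c)))) (annotations C)" for c
  define Qs where "Qs c \<alpha> = set (cqueries \<alpha> (v c) (cgates C))" for c \<alpha>
  define orc where "orc f i = set_oracle n (bump {..<i} (\<lambda>i. dup (E (f i))) (\<lambda>i. E (f (Suc i))))"
    for f i
  have "\<exists>f. (\<forall>j\<le>L. f j \<in> W) \<and> inj_on f {..L} \<and>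
    (\<forall>j\<le>L. \<forall>i<j. \<forall>X\<in>Qs (f 0) (orc f i). \<not> sdist (ones X) (dup (E (f j))) < 4 * w)"
    unfolding orc_def
  proof (rule chain_exists [where encP = "\<lambda>i c. dup (E c)" and encQ = "\<lambda>i c. E c"
        and G = "csize C" and zone = "\<lambda>j c A. sdist A (dup (E c)) < 4 * w"])
    show "finite (Qs c \<alpha>)" for c \<alpha> by (simp add: Qs_def)
    show "card (Qs c \<alpha>) \<le> csize C" for c \<alpha>
    proof -
      have "card (Qs c \<alpha>) \<le> length (cqueries \<alpha> (v c) (cgates C))"
        unfolding Qs_def by (rule card_length)
      also have "\<dots> \<le> length (cgates C)" by (rule length_cqueries)
      finally show ?thesis by (simp add: csize_def)
    qed
    show "c = d" if "j \<le> L" "c \<in> W" "d \<in> W" "finite A"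
      "sdist A (dup (E c)) < 4 * w" "sdist A (dup (E d)) < 4 * w" for j c d A
    proof (rule ccontr)
      assume "c \<noteq> d"
      have "sdist (dup (E c)) (dup (E d)) \<le> sdist (dup (E c)) A + sdist A (dup (E d))"
        using that(4) fin_E by (intro sdist_triangle)
      then show False
        using dist_E [OF that(2,3) \<open>c \<noteq> d\<close>] that by (simp add: sdist_commute)
    qed
  qed (rule card)
  then obtain f where f: "\<And>j. j \<le> L \<Longrightarrow> f j \<in> W" and inj: "inj_on f {..L}"
    and fresh: "\<And>i j X. j \<le> L \<Longrightarrow> i < j \<Longrightarrow> X \<in> Qs (f 0) (orc f i) \<Longrightarrow>
      \<not> sdist (ones X) (dup (E (f j))) < 4 * w" by blast
  define P where "P i = dup (E (f i))" for i
  define Q where "Q i = E (f (Suc i))" for i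
  have card_P: "card (P i) = 5 * w" if "i < L" for i
    unfolding P_def card_dup using f [of i] that by (simp add: card_E)
  have card_Q: "card (Q i) = w" if "i < L" for i
    unfolding Q_def using f [of "Suc i"] that by (simp add: card_E)
  interpret bumps n L P Q
  proof
    fix i assume i: "i < L"
    show "P i \<subseteq> {..<n}"
      unfolding P_def using f [of i] i sub_E n by (intro dup_sub [where k = "t ^ 6 + 2"]) auto
    have "Q i \<subseteq> {..<t ^ 6 + 2}" unfolding Q_def using f [of "Suc i"] i by (intro sub_E) auto
    also have "\<dots> \<subseteq> {..<n}" using n by auto
    finally show "Q i \<subseteq> {..<n}" .
    show "0 \<in> Q i" by (simp add: Q_def E_def enc_def)
    show "even (card (P i) + card (Q i))" using card_P [OF i] card_Q [OF i] by simp
    fix j assume j: "j < L" and "i \<noteq> j"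
    then have "f i \<noteq> f j" using inj i by (auto dest: inj_onD)
    then have "8 * w \<le> sdist (P i) (P j)"
      unfolding P_def using f i j by (intro dist_E) auto
    then show "card (Q i) + card (Q j) \<le> sdist (P i) (P j)"
      using card_Q [OF i] card_Q [OF j] by simp
  qed
  let ?X = "bits n (P 0)"
  have orc: "bump_oracle {..<i} = orc f i" for i by (simp add: orc_def P_def [abs_def] Q_def [abs_def])
  have v: "v (f 0) = map (annotation_val ?X) (annotations C)" by (simp add: v_def P_def)
  have "fold (cgate_step (bump_oracle {..<L - 1})) (cgates C) (v (f 0))
      = fold (cgate_step (bump_oracle {..<L})) (cgates C) (v (f 0))"
  proof (rule ccontr)
    assume differ: "fold (cgate_step (bump_oracle {..<L - 1})) (cgates C) (v (f 0))
      \<noteq> fold (cgate_step (bump_oracle {..<L})) (cgates C) (v (f 0))"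
    have "2 ^ (L - 1) \<le> length (cgates C)"
    proof (rule many_queries [OF _ card_Q _ L _ differ])
      show "\<forall>g\<in>set (cgates C). wf_cgate n (length (v (f 0))) g"
        using wf by (simp add: wf_ccircuit_def n_def v_def)
      show "0 < n" using n by simp
      fix i j A assume "i < j" "j < L" "A \<in> set (cqueries (bump_oracle {..<i}) (v (f 0)) (cgates C))"
      then show "4 * w \<le> sdist (ones A) (P j)"
        using fresh [of j i A] unfolding orc P_def Qs_def by simp
    qed
    then show False using short by (simp add: csize_def L_def n_def)
  qed
  then have "ceval (bump_oracle {..<L - 1}) ?X C = ceval (bump_oracle {..<L}) ?X C"
    by (simp add: ceval_def v)
  moreover have "beval (bump_oracle {..<L}) ?X (dup_circuit (length ?X))"
    "\<not> beval (bump_oracle {..<L - 1}) ?X (dup_circuit (length ?X))"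
  proof -
    have "beval (bump_oracle I) ?X (dup_circuit (length ?X)) = bump_oracle I (bits n (P (L - 1))) ! 1"
      if "{..<L - 1} \<subseteq> I" "I \<subseteq> {..<L}" for I
    proof -
      have "dup_query (bump_oracle I) ?X (L - 1) = bits n (P (L - 1))"
        using that L by (intro dup_query_bump_oracle) (auto simp: P_def Q_def)
      then show ?thesis using n by (subst beval_dup_circuit) (simp_all add: L_def)
    qed
    moreover have "1 \<in> Q (L - 1)" by (simp add: Q_def E_def enc_def)
    ultimately show "beval (bump_oracle {..<L}) ?X (dup_circuit (length ?X))"
      "\<not> beval (bump_oracle {..<L - 1}) ?X (dup_circuit (length ?X))"
      using bump_center_bit n L by auto
  qed
  moreover have "bump_oracle {..<L} \<in> Strict_Lipschitz_Oracles"
    "bump_oracle {..<L - 1} \<in> Strict_Lipschitz_Oracles"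
    using n by (auto intro!: bump_strict)
  ultimately show ?thesis unfolding n_def [symmetric] by (metis length_bits)
qed

section \<open>Asymptotic comparison of the bounds\<close>

lemma bigo_power_bound:
  assumes "(\<lambda>n. real (f n)) \<in> O(\<lambda>n. real n ^ c)"
  shows "\<forall>\<^sub>F n in sequentially. f n \<le> n ^ Suc c"
proof -
  obtain K where K: "\<forall>\<^sub>F n in sequentially. norm (real (f n)) \<le> K * norm (real n ^ c)"
    using assms by (elim landau_o.bigE)
  have "\<forall>\<^sub>F n in sequentially. K \<le> real n"
    by (rule eventually_sequentiallyI [of "nat \<lceil>K\<rceil>"]) linarith
  with K show ?thesis
  proof eventually_elim
    case (elim n)
    have "real (f n) \<le> K * real n ^ c" using elim by simp
    also have "\<dots> \<le> real n * real n ^ c" using elim by (intro mult_right_mono) auto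
    also have "\<dots> = real (n ^ Suc c)" by simp
    finally show ?case by (simp only: of_nat_le_iff)
  qed
qed

lemma filterlim_power8: "filterlim (\<lambda>t::nat. t ^ 8) sequentially sequentially"
proof (rule filterlim_at_top_mono [OF filterlim_ident])
  show "\<forall>\<^sub>F t in sequentially. (t::nat) \<le> t ^ 8"
    using eventually_gt_at_top [of 0] by eventually_elim (rule self_le_power; simp)
qed

lemma eventually_power8:
  assumes "\<forall>\<^sub>F n in sequentially. R n"
  shows "\<forall>\<^sub>F t in sequentially. R (t ^ 8)"
  using filterlim_power8 assms by (rule eventually_compose_filterlim [rotated])

text \<open>At length \<open>t ^ 8\<close> the logarithm is a constant multiple of
  \<open>ln t\<close>, and a power of \<open>ln t\<close> is eventually below \<open>t\<close>,
  whatever the constant factor.\<close>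

lemma bigo_log_power_bound:
  assumes "(\<lambda>n. real (f n)) \<in> O(\<lambda>n. log 2 (real n) ^ e)"
  shows "\<forall>\<^sub>F t in sequentially. f (t ^ 8) < t"
proof -
  obtain K where K0: "0 < K"
    and K: "\<forall>\<^sub>F n in sequentially. norm (real (f n)) \<le> K * norm (log 2 (real n) ^ e)"
    using assms by (elim landau_o.bigE)
  have K': "\<forall>\<^sub>F t in sequentially.
      norm (real (f (t ^ 8))) \<le> K * norm (log 2 (real (t ^ 8)) ^ e)"
    by (rule eventually_power8 [OF K])
  have "((\<lambda>t. ln (real t) ^ e / exp (ln (real t))) \<longlongrightarrow> 0) sequentially"
    by (rule filterlim_compose [OF tendsto_power_div_exp_0])
      (rule filterlim_compose [OF ln_at_top filterlim_real_sequentially])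
  then have "((\<lambda>t. K * (8 / ln 2) ^ e * (ln (real t) ^ e / exp (ln (real t)))) \<longlongrightarrow>
      K * (8 / ln 2) ^ e * 0) sequentially"
    by (intro tendsto_mult tendsto_const)
  then have "\<forall>\<^sub>F t in sequentially. K * (8 / ln 2) ^ e * (ln (real t) ^ e / exp (ln (real t))) < 1"
    by (intro order_tendstoD(2) [where y = "K * (8 / ln 2) ^ e * 0"]) auto
  with K' show ?thesis
    using eventually_gt_at_top [of 0]
  proof eventually_elim
    case (elim t)
    have log: "log 2 (real (t ^ 8)) = 8 / ln 2 * ln (real t)"
      using elim by (simp add: log_def ln_realpow)
    then have "0 \<le> log 2 (real (t ^ 8))" using elim by simp
    then have "K * norm (log 2 (real (t ^ 8)) ^ e) = K * log 2 (real (t ^ 8)) ^ e"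
      by (simp only: real_norm_def abs_of_nonneg zero_le_power)
    also have "\<dots> = K * (8 / ln 2) ^ e * ln (real t) ^ e"
      by (simp only: log power_mult_distrib mult.assoc)
    also have "\<dots> < real t"
      using elim by (simp add: divide_simps mult.commute)
    finally show ?case using elim(1) by simp
  qed
qed

text \<open>At length \<open>t ^ 8\<close> the relation takes \<open>t\<close> iterations, while a
  polylogarithmic nesting depth stays below \<open>t\<close>.\<close>

lemma iteration_not_in_NC:
  assumes C: "NC_family k C"
  shows "\<not> bcomputes Strict_Lipschitz_Oracles C (\<lambda>X \<alpha>. ceval \<alpha> X (iter_circuit (length X)))"
proof
  assume computes: "bcomputes Strict_Lipschitz_Oracles C (\<lambda>X \<alpha>. ceval \<alpha> X (iter_circuit (length X)))"
  obtain c where size: "(\<lambda>n. real (bsize (C n))) \<in> O(\<lambda>n. real n ^ c)"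
    and depth: "(\<lambda>n. real (oracle_depth (C n))) \<in> O(\<lambda>n. log 2 (real n) ^ (k - 1))"
    and wf: "\<And>n. wf_bcircuit n (C n)"
    using C by (auto simp: NC_family_def)
  \<comment> \<open>Chosen so that \<open>2 * m = 8 * c + 12\<close> exceeds the exponent
    \<open>10 + 8 * c\<close> of the size bound below.\<close>
  define m where "m = 4 * c + 6"
  have "\<forall>\<^sub>F t in sequentially. bsize (C (t ^ 8)) \<le> (t ^ 8) ^ Suc c \<and>
      oracle_depth (C (t ^ 8)) < t \<and> 4 * (m + 1) \<le> t"
    using eventually_power8 [OF bigo_power_bound [OF size]] bigo_log_power_bound [OF depth]
      eventually_ge_at_top [of "4 * (m + 1)"]
    by eventually_elim simp
  then obtain t where t: "bsize (C (t ^ 8)) \<le> (t ^ 8) ^ Suc c" "oracle_depth (C (t ^ 8)) < t"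
    "4 * (m + 1) \<le> t"
    using eventually_happens by force
  have t3: "3 \<le> t" using t(3) by simp
  have "2 * (m + 1) * (t + 1) \<le> 2 * (m + 1) * (2 * t)" using t3 by (intro mult_le_mono2) simp
  also have "\<dots> = 4 * (m + 1) * t" by (simp add: algebra_simps)
  also have "\<dots> \<le> t * t" using t(3) by (rule mult_le_mono1)
  finally have margin: "2 * (m + 1) * (t + 1) \<le> t ^ 2" by (simp add: power2_eq_square)
  let ?G = "t ^ (8 * Suc c)"
  have "1 \<le> ?G" using t3 by simp
  have "bsize (C (t ^ 8)) \<le> ?G" using t(1) by (simp only: power_mult)
  then have "t * (bsize (C (t ^ 8)) + 1) \<le> t * (?G + 1)" by simp
  also have "\<dots> \<le> t * (t * ?G)"
  proof (intro mult_le_mono2)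
    have "?G + 1 \<le> 2 * ?G" using \<open>1 \<le> ?G\<close> by linarith
    also have "\<dots> \<le> t * ?G" using t3 by (intro mult_le_mono1) simp
    finally show "?G + 1 \<le> t * ?G" .
  qed
  also have "\<dots> = t ^ (10 + 8 * c)" by (simp flip: power_Suc)
  also have "\<dots> < t ^ (2 * m)" using t3 by (intro power_strict_increasing) (auto simp: m_def)
  finally have "t * (bsize (C (t ^ 8)) + 1) < t ^ (2 * m)" .
  from iteration_needs_depth [OF t3 margin wf t(2) this]
  obtain X \<alpha> where X: "\<alpha> \<in> Strict_Lipschitz_Oracles" "length X = t ^ 8"
    "beval \<alpha> X (C (t ^ 8)) \<noteq> (\<alpha> ^^ t) X ! 1" by blast
  have "2 \<le> length X" using X(2) t3 self_le_power [of t 8] by linarith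
  moreover have "length_preserving \<alpha>" using X(1) by (simp add: Strict_Lipschitz_Oracles_def)
  ultimately have "ceval \<alpha> X (iter_circuit (length X)) = (\<alpha> ^^ t) X ! 1"
    using X(2) iter_count_power8 [of t] ceval_iter_circuit by metis
  moreover have "beval \<alpha> X (C (length X)) = ceval \<alpha> X (iter_circuit (length X))"
    using computes X(1) by (simp add: bcomputes_def)
  ultimately show False using X(2,3) by simp
qed

text \<open>A polynomial size bound is exponential in log n, hence eventually less than the
  exponential in log^2 n that \<open>duplication_needs_size\<close> forces.\<close>

lemma duplication_not_comparator:
  assumes C: "comparator_family C"
  shows "\<not> ccomputes Strict_Lipschitz_Oracles C (\<lambda>X \<alpha>. beval \<alpha> X (dup_circuit (length X)))"
proof
  assume computes: "ccomputes Strict_Lipschitz_Oracles C (\<lambda>X \<alpha>. beval \<alpha> X (dup_circuit (length X)))"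
  obtain c where size: "(\<lambda>n. real (csize (C n))) \<in> O(\<lambda>n. real n ^ c)"
    and wf: "\<And>n. wf_ccircuit n (C n)"
    using C by (auto simp: comparator_family_def)
  \<comment> \<open>Here \<open>2 * m = 8 * c + 26\<close> has to exceed the exponent
    \<open>25 + 8 * c\<close>, as \<open>dup_count n\<close> is bounded by
    \<open>n ^ 2 = t ^ 16\<close>.\<close>
  define m where "m = 4 * c + 13"
  have "\<forall>\<^sub>F t in sequentially. csize (C (t ^ 8)) \<le> (t ^ 8) ^ Suc c \<and>
      5 * (m + 1) \<le> t \<and> 2 ^ (c + 3) \<le> t"
    using eventually_power8 [OF bigo_power_bound [OF size]]
      eventually_ge_at_top [of "5 * (m + 1)"] eventually_ge_at_top [of "2 ^ (c + 3)"]
    by eventually_elim simp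
  then obtain t where t: "csize (C (t ^ 8)) \<le> (t ^ 8) ^ Suc c" "5 * (m + 1) \<le> t" "2 ^ (c + 3) \<le> t"
    using eventually_happens by force
  define n where "n = t ^ 8"
  define l where "l = floor_log n"
  have t3: "3 \<le> t" using t(2) by simp
  have tn: "t \<le> n" unfolding n_def using t3 by (intro self_le_power) auto
  have "t \<le> t ^ 2" using t3 by (intro self_le_power) auto
  then have margin: "5 * (m + 1) \<le> t ^ 2 + 2" using t(2) by linarith
  \<comment> \<open>This gives \<open>Suc c \<le> l - 2\<close>, so that
    \<open>Suc l * Suc c\<close> stays below the square of \<open>l\<close>.\<close>
  have l: "c + 3 \<le> l"
    using floor_log_le_iff [of "2 ^ (c + 3)" n] t(3) tn by (simp add: l_def)
  have ln: "l \<le> n"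
  proof -
    have "l < 2 ^ l" by (rule less_exp)
    also have "\<dots> \<le> n" unfolding l_def using tn t3 by (intro floor_log_exp2_le) simp
    finally show ?thesis by simp
  qed
  let ?G = "t ^ (8 * Suc c)"
  have "1 \<le> ?G" using t3 by simp
  have "csize (C n) \<le> ?G" using t(1) by (simp only: n_def power_mult)
  then have "dup_count n * (csize (C n) + 1) \<le> n ^ 2 * (?G + 1)"
    using ln unfolding dup_count_def l_def [symmetric] by (intro mult_le_mono power_mono) auto
  also have "\<dots> \<le> n ^ 2 * (t * ?G)"
  proof (intro mult_le_mono2)
    have "?G + 1 \<le> 2 * ?G" using \<open>1 \<le> ?G\<close> by linarith
    also have "\<dots> \<le> t * ?G" using t3 by (intro mult_le_mono1) simp
    finally show "?G + 1 \<le> t * ?G" .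
  qed
  also have "\<dots> = t ^ (25 + 8 * c)"
    unfolding n_def by (simp flip: power_Suc power_mult power_add)
  also have "\<dots> < t ^ (2 * m)" using t3 by (intro power_strict_increasing) (auto simp: m_def)
  finally have count: "dup_count (t ^ 8) * (csize (C (t ^ 8)) + 1) < t ^ (2 * m)"
    by (simp add: n_def)
  have "csize (C n) \<le> n ^ Suc c" using t(1) by (simp add: n_def)
  also have "\<dots> < (2 ^ Suc l) ^ Suc c"
    using floor_log_exp2_gt [of n] by (intro power_strict_mono) (auto simp: l_def)
  also have "\<dots> = 2 ^ (Suc l * Suc c)" by (simp only: power_mult)
  also have "\<dots> \<le> 2 ^ (dup_count n - 1)"
  proof (rule power_increasing)
    have "Suc l * Suc c \<le> Suc l * (l - 2)" using l by (intro mult_le_mono2) simp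
    moreover have "Suc l * (l - 2) + 1 \<le> l * l"
    proof -
      obtain d where "l = 2 + d" using l le_Suc_ex [of 2 l] by auto
      then show ?thesis by (simp add: algebra_simps)
    qed
    ultimately show "Suc l * Suc c \<le> dup_count n - 1"
      by (simp add: dup_count_def l_def power2_eq_square)
  qed simp
  finally have short: "csize (C (t ^ 8)) < 2 ^ (dup_count (t ^ 8) - 1)" by (simp add: n_def)
  from duplication_needs_size [OF t3 margin wf count short]
  obtain X \<alpha> where X: "\<alpha> \<in> Strict_Lipschitz_Oracles" "length X = t ^ 8"
    "ceval \<alpha> X (C (t ^ 8)) \<noteq> beval \<alpha> X (dup_circuit (length X))" by blast
  have "ceval \<alpha> X (C (length X)) = beval \<alpha> X (dup_circuit (length X))"
    using computes X(1) by (simp add: ccomputes_def)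
  then show False using X(2,3) by simp
qed

theorem theorem14:
  shows
    "(\<exists>R1 :: relation.
        (\<exists>C. uniform_comparator_family C \<and> ccomputes Oracles C R1) \<and>
        \<not> (\<exists>k \<ge> 1. \<exists>C. NC_family k C \<and> bcomputes Strict_Lipschitz_Oracles C R1)) \<and>
     (\<exists>R2 :: relation.
        (\<exists>C. uniform_NC_family 3 C \<and> bcomputes Oracles C R2) \<and>
        \<not> (\<exists>C. comparator_family C \<and> ccomputes Strict_Lipschitz_Oracles C R2))"
proof (rule conjI)
  \<comment> \<open>Both relations are defined as the values of the circuits themselves, so these
    circuits compute them for all oracles by definition.\<close>
  let ?R1 = "\<lambda>X \<alpha>. ceval \<alpha> X (iter_circuit (length X))"
  let ?R2 = "\<lambda>X \<alpha>. beval \<alpha> X (dup_circuit (length X))"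
  have "ccomputes Oracles iter_circuit ?R1" by (simp add: ccomputes_def)
  then show "\<exists>R1 :: relation.
      (\<exists>C. uniform_comparator_family C \<and> ccomputes Oracles C R1) \<and>
      \<not> (\<exists>k \<ge> 1. \<exists>C. NC_family k C \<and> bcomputes Strict_Lipschitz_Oracles C R1)"
    using iter_circuit_family iteration_not_in_NC by (intro exI [of _ ?R1]) blast
  have "bcomputes Oracles dup_circuit ?R2" by (simp add: bcomputes_def)
  then show "\<exists>R2 :: relation.
      (\<exists>C. uniform_NC_family 3 C \<and> bcomputes Oracles C R2) \<and>
      \<not> (\<exists>C. comparator_family C \<and> ccomputes Strict_Lipschitz_Oracles C R2)"
    using dup_circuit_family duplication_not_comparator by (intro exI [of _ ?R2]) blast
qed

end
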